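(* Let $\mathbf{k}$ be a commutative ring, and let $H$ be a graded $\mathbf{k}$-bialgebra all of whose graded components are finite free $\mathbf{k}$-modules. Consider its graded dual $H^o$. Let $\alpha=(\alpha_1,\ldots,\alpha_k)$ be a weak composition of length $k$, and let $\sigma\in\mathfrak{S}_k$ be a permutation. Then $$\left(p_{\alpha,\sigma}\text{ for }H^o\right)=\left(p_{\alpha\cdot\sigma^{-1},\ \sigma^{-1}}\text{ for }H\right)^{*}\Big|_{H^o}$$ (the dual map of $p_{\alpha\cdot\sigma^{-1},\sigma^{-1}}:H\to H$, restricted to $H^o$) as endomorphisms of $H^o$.
   Context: $\mathbb{N}=\{0,1,2,\ldots\}$; $[k]=\{1,2,\ldots,k\}$; $\mathfrak{S}_k$ is the group of permutations of $[k]$. All structures are over the commutative ring $\mathbf{k}$. "Graded" means $\mathbb{N}$-graded; a graded bialgebra $H=\bigoplus_{n\in\mathbb{N}}H_n$ is a bialgebra whose multiplication, unit, comultiplication and counit are graded maps (no sign twists in tensor products). "Finite free" means free with a finite basis. If all $H_n$ are finite free, the graded dual $H^o:=\bigoplus_{n\in\mathbb{N}}(H_n)^*\subseteq H^*$ is itself a graded bialgebra, with multiplication dual to $\Delta_H$ and comultiplication dual to $m_H$. For a graded bialgebra $H$: $p_n:H\to H$ is the canonical projection onto $H_n$. The maps $m^{[k]}:H^{\otimes k}\to H$ and $\Delta^{[k]}:H\to H^{\otimes k}$ are the $k$-fold iterated multiplication and comultiplication ($m^{[0]}=u$ is the unit map, $\Delta^{[0]}=\epsilon$ is the counit). The group $\mathfrak{S}_k$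 acts on $H^{\otimes k}$ from the left by $\sigma\cdot(h_1\otimes\cdots\otimes h_k)=h_{\sigma^{-1}(1)}\otimes\cdots\otimes h_{\sigma^{-1}(k)}$. A weak composition is a finite tuple of nonnegative integers. For $\alpha=(\alpha_1,\ldots,\alpha_k)\in\mathbb{N}^k$, let $P_\alpha:=p_{\alpha_1}\otimes\cdots\otimes p_{\alpha_k}$. For $\alpha\in\mathbb{N}^k$ and $\sigma\in\mathfrak{S}_k$, define $p_{\alpha,\sigma}:=m^{[k]}\circ P_\alpha\circ\sigma^{-1}\circ\Delta^{[k]}:H\to H$, where $\sigma^{-1}$ means the action of $\sigma^{-1}$ on $H^{\otimes k}$. The notation "$p_{\alpha,\sigma}$ for $H$" indicates that this endomorphism is formed for the graded bialgebra $H$. $\mathfrak{S}_k$ acts on $\mathbb{N}^k$ from the right by $(\gamma_1,\ldots,\gamma_k)\cdot\pi=(\gamma_{\pi(1)},\ldots,\gamma_{\pi(k)})$; this is the action used in $\alpha\cdot\sigma^{-1}$. *)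

theory Defs
  imports "HOL-Algebra.Module" "HOL-Combinatorics.Permutations"
begin

section \<open>Tensor powers of a module\<close>

text \<open>
  A formal sum \<open>[(c\<^sub>1, hs\<^sub>1), \<dots>, (c\<^sub>n, hs\<^sub>n)]\<close> stands for
  \<open>\<Sum>\<^sub>j c\<^sub>j \<cdot> (hs\<^sub>j ! 0 \<otimes> \<dots> \<otimes> hs\<^sub>j ! (k - 1))\<close>. The \<open>k\<close>-th tensor power of \<open>M\<close> consists of the
  formal sums modulo the congruence \<open>tensor_eq\<close>: the rules up to \<open>zero\<close> present the free
  \<open>R\<close>-module on \<open>(carrier M)\<^sup>k\<close>, and the last two impose multilinearity. For \<open>k = 0\<close> this is \<open>R\<close>
  (via \<open>c \<mapsto> [(c, [])]\<close>), and for \<open>k = 1\<close> it is \<open>M\<close> (via \<open>x \<mapsto> [(\<one>, [x])]\<close>).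
\<close>

type_synonym ('a, 'b) formal_sum = "('a \<times> 'b list) list"

definition tuples :: "('a, 'b, 'm) module_scheme \<Rightarrow> nat \<Rightarrow> 'b list set" where
  "tuples M k = {hs. length hs = k \<and> set hs \<subseteq> carrier M}"

definition formal_sums ::
  "('a, 'r) ring_scheme \<Rightarrow> ('a, 'b, 'm) module_scheme \<Rightarrow> nat \<Rightarrow> ('a, 'b) formal_sum set" where
  "formal_sums R M k = lists (carrier R \<times> tuples M k)"

inductive tensor_eq ::
  "('a, 'r) ring_scheme \<Rightarrow> ('a, 'b, 'm) module_scheme \<Rightarrow> nat \<Rightarrow>
    ('a, 'b) formal_sum \<Rightarrow> ('a, 'b) formal_sum \<Rightarrow> bool"
  for R :: "('a, 'r) ring_scheme" and M :: "('a, 'b, 'm) module_scheme" and k :: nat where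
  refl: "t \<in> formal_sums R M k \<Longrightarrow> tensor_eq R M k t t"
| sym: "tensor_eq R M k s t \<Longrightarrow> tensor_eq R M k t s"
| trans: "tensor_eq R M k s t \<Longrightarrow> tensor_eq R M k t u \<Longrightarrow> tensor_eq R M k s u"
| append: "tensor_eq R M k s s' \<Longrightarrow> tensor_eq R M k t t' \<Longrightarrow> tensor_eq R M k (s @ t) (s' @ t')"
| commute: "s \<in> formal_sums R M k \<Longrightarrow> t \<in> formal_sums R M k \<Longrightarrow> tensor_eq R M k (s @ t) (t @ s)"
| coeff_add: "c \<in> carrier R \<Longrightarrow> d \<in> carrier R \<Longrightarrow> hs \<in> tuples M k \<Longrightarrow>
    tensor_eq R M k [(c \<oplus>\<^bsub>R\<^esub> d, hs)] [(c, hs), (d, hs)]"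
| zero: "hs \<in> tuples M k \<Longrightarrow> tensor_eq R M k [(\<zero>\<^bsub>R\<^esub>, hs)] []"
| slot_add: "c \<in> carrier R \<Longrightarrow> hs \<in> tuples M k \<Longrightarrow> i < k \<Longrightarrow> x \<in> carrier M \<Longrightarrow> y \<in> carrier M \<Longrightarrow>
    tensor_eq R M k [(c, hs[i := x \<oplus>\<^bsub>M\<^esub> y])] [(c, hs[i := x]), (c, hs[i := y])]"
| slot_smult: "c \<in> carrier R \<Longrightarrow> a \<in> carrier R \<Longrightarrow> hs \<in> tuples M k \<Longrightarrow> i < k \<Longrightarrow> x \<in> carrier M \<Longrightarrow>
    tensor_eq R M k [(c, hs[i := a \<odot>\<^bsub>M\<^esub> x])] [(c \<otimes>\<^bsub>R\<^esub> a, hs[i := x])]"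

type_synonym ('a, 'b) tensor = "('a, 'b) formal_sum set"

definition tensor_rel ::
  "('a, 'r) ring_scheme \<Rightarrow> ('a, 'b, 'm) module_scheme \<Rightarrow> nat \<Rightarrow>
    (('a, 'b) formal_sum \<times> ('a, 'b) formal_sum) set" where
  "tensor_rel R M k = {(s, t). tensor_eq R M k s t}"

text \<open>
  The multiplication below is the factorwise one of \<open>M\<^sup>\<otimes>\<^sup>k\<close> for an algebra \<open>M\<close> (without signs).
\<close>

definition tensor_power ::
  "('a, 'r) ring_scheme \<Rightarrow> ('a, 'b, 'm) module_scheme \<Rightarrow> nat \<Rightarrow> ('a, ('a, 'b) tensor) module" where
  "tensor_power R M k = \<lparr>
     carrier = formal_sums R M k // tensor_rel R M k,
     monoid.mult = (\<lambda>S T. \<Union>s\<in>S. \<Union>t\<in>T. tensor_rel R M k ``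
       {[(c \<otimes>\<^bsub>R\<^esub> d, map2 (\<lambda>x y. x \<otimes>\<^bsub>M\<^esub> y) hs ks). (c, hs) \<leftarrow> s, (d, ks) \<leftarrow> t]}),
     one = tensor_rel R M k `` {[(\<one>\<^bsub>R\<^esub>, replicate k \<one>\<^bsub>M\<^esub>)]},
     zero = tensor_rel R M k `` {[]},
     add = (\<lambda>S T. \<Union>s\<in>S. \<Union>t\<in>T. tensor_rel R M k `` {s @ t}),
     smult = (\<lambda>c T. \<Union>t\<in>T. tensor_rel R M k `` {[(c \<otimes>\<^bsub>R\<^esub> d, hs). (d, hs) \<leftarrow> t]}) \<rparr>"

definition pure_tensor ::
  "('a, 'r) ring_scheme \<Rightarrow> ('a, 'b, 'm) module_scheme \<Rightarrow> 'b list \<Rightarrow> ('a, 'b) tensor" where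
  "pure_tensor R M hs = tensor_rel R M (length hs) `` {[(\<one>\<^bsub>R\<^esub>, hs)]}"

text \<open>
  \<open>tensor_lift N \<phi>\<close> is the linear map from a tensor power to the module \<open>N\<close> that sends each pure
  tensor \<open>hs ! 0 \<otimes> \<dots> \<otimes> hs ! (k - 1)\<close> to \<open>\<phi> hs\<close>. It is only applied to multilinear \<open>\<phi>\<close>, for which
  the choice of the representing formal sum does not matter.
\<close>

primrec formal_eval ::
  "('a, 'c, 'n) module_scheme \<Rightarrow> ('b list \<Rightarrow> 'c) \<Rightarrow> ('a, 'b) formal_sum \<Rightarrow> 'c" where
  "formal_eval N \<phi> [] = \<zero>\<^bsub>N\<^esub>"
| "formal_eval N \<phi> (p # t) = (fst p \<odot>\<^bsub>N\<^esub> \<phi> (snd p)) \<oplus>\<^bsub>N\<^esub> formal_eval N \<phi> t"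

definition tensor_lift ::
  "('a, 'c, 'n) module_scheme \<Rightarrow> ('b list \<Rightarrow> 'c) \<Rightarrow> ('a, 'b) tensor \<Rightarrow> 'c" where
  "tensor_lift N \<phi> T = formal_eval N \<phi> (SOME t. t \<in> T)"

text \<open>The canonical map \<open>M\<^sup>\<otimes>\<^sup>k \<times> M\<^sup>\<otimes>\<^sup>l \<rightarrow> M\<^sup>\<otimes>\<^sup>(\<^sup>k\<^sup>+\<^sup>l\<^sup>)\<close>.\<close>

definition tensor_concat ::
  "('a, 'r) ring_scheme \<Rightarrow> ('a, 'b, 'm) module_scheme \<Rightarrow> nat \<Rightarrow> nat \<Rightarrow>
    ('a, 'b) tensor \<Rightarrow> ('a, 'b) tensor \<Rightarrow> ('a, 'b) tensor" where
  "tensor_concat R M k l S T =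
     tensor_lift (tensor_power R M (k + l))
       (\<lambda>hs. tensor_lift (tensor_power R M (k + l)) (\<lambda>ks. pure_tensor R M (hs @ ks)) T) S"

text \<open>For \<open>\<phi> : M \<rightarrow> M\<^sup>\<otimes>\<^sup>k\<close> and \<open>\<psi> : M \<rightarrow> M\<^sup>\<otimes>\<^sup>l\<close>, the map \<open>\<phi> \<otimes> \<psi> : M \<otimes> M \<rightarrow> M\<^sup>\<otimes>\<^sup>(\<^sup>k\<^sup>+\<^sup>l\<^sup>)\<close>.\<close>

definition tensor_maps ::
  "('a, 'r) ring_scheme \<Rightarrow> ('a, 'b, 'm) module_scheme \<Rightarrow> nat \<Rightarrow> nat \<Rightarrow>
    ('b \<Rightarrow> ('a, 'b) tensor) \<Rightarrow> ('b \<Rightarrow> ('a, 'b) tensor) \<Rightarrow> ('a, 'b) tensor \<Rightarrow> ('a, 'b) tensor" where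
  "tensor_maps R M k l \<phi> \<psi> =
     tensor_lift (tensor_power R M (k + l)) (\<lambda>hs. tensor_concat R M k l (\<phi> (hs ! 0)) (\<psi> (hs ! 1)))"

text \<open>The left action \<open>\<sigma> \<cdot> (h\<^sub>1 \<otimes> \<dots> \<otimes> h\<^sub>k) = h\<^bsub>\<sigma>\<^sup>-\<^sup>1(1)\<^esub> \<otimes> \<dots> \<otimes> h\<^bsub>\<sigma>\<^sup>-\<^sup>1(k)\<^esub>\<close>, with positions counted from 0.\<close>

definition tensor_permute ::
  "('a, 'r) ring_scheme \<Rightarrow> ('a, 'b, 'm) module_scheme \<Rightarrow> nat \<Rightarrow> (nat \<Rightarrow> nat) \<Rightarrow>
    ('a, 'b) tensor \<Rightarrow> ('a, 'b) tensor" where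
  "tensor_permute R M k \<sigma> =
     tensor_lift (tensor_power R M k) (\<lambda>hs. pure_tensor R M (permute_list (inv_into UNIV \<sigma>) hs))"


section \<open>Graded bialgebras\<close>

definition ring_as_module :: "('a, 'r) ring_scheme \<Rightarrow> ('a, 'a) module" where
  "ring_as_module R = \<lparr>carrier = carrier R, monoid.mult = monoid.mult R, one = one R,
     zero = zero R, add = add R, smult = monoid.mult R\<rparr>"

definition module_hom ::
  "('a, 'r) ring_scheme \<Rightarrow> ('a, 'b, 'm) module_scheme \<Rightarrow> ('a, 'c, 'n) module_scheme \<Rightarrow>
    ('b \<Rightarrow> 'c) set" where
  "module_hom R M N = {\<phi> \<in> carrier M \<rightarrow> carrier N.
     (\<forall>x\<in>carrier M. \<forall>y\<in>carrier M. \<phi> (x \<oplus>\<^bsub>M\<^esub> y) = \<phi> x \<oplus>\<^bsub>N\<^esub> \<phi> y) \<and>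
     (\<forall>c\<in>carrier R. \<forall>x\<in>carrier M. \<phi> (c \<odot>\<^bsub>M\<^esub> x) = c \<odot>\<^bsub>N\<^esub> \<phi> x)}"

definition finite_free ::
  "('a, 'r) ring_scheme \<Rightarrow> ('a, 'b, 'm) module_scheme \<Rightarrow> 'b set \<Rightarrow> bool" where
  "finite_free R M N \<longleftrightarrow> (\<exists>B. finite B \<and> B \<subseteq> N \<and>
     (\<forall>x\<in>N. \<exists>!c. c \<in> B \<rightarrow>\<^sub>E carrier R \<and> x = (\<Oplus>\<^bsub>M\<^esub>b\<in>B. c b \<odot>\<^bsub>M\<^esub> b)))"

record ('a, 'b) graded_bialgebra = "('a, 'b) module" +
  comult :: "'b \<Rightarrow> ('a, 'b) tensor"
  counit :: "'b \<Rightarrow> 'a"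
  component :: "nat \<Rightarrow> 'b set"

locale bialgebra = module R H + ring H
  for R :: "('a, 'r) ring_scheme" (structure)
    and H :: "('a, 'b, 'h) graded_bialgebra_scheme" (structure) +
  assumes smult_mult_left:
      "\<lbrakk>c \<in> carrier R; x \<in> carrier H; y \<in> carrier H\<rbrakk> \<Longrightarrow>
        (c \<odot>\<^bsub>H\<^esub> x) \<otimes>\<^bsub>H\<^esub> y = c \<odot>\<^bsub>H\<^esub> (x \<otimes>\<^bsub>H\<^esub> y)"
    and smult_mult_right:
      "\<lbrakk>c \<in> carrier R; x \<in> carrier H; y \<in> carrier H\<rbrakk> \<Longrightarrow>
        x \<otimes>\<^bsub>H\<^esub> (c \<odot>\<^bsub>H\<^esub> y) = c \<odot>\<^bsub>H\<^esub> (x \<otimes>\<^bsub>H\<^esub> y)"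
    and comult_linear: "comult H \<in> module_hom R H (tensor_power R H 2)"
    and counit_linear: "counit H \<in> module_hom R H (ring_as_module R)"
    and coassoc: "h \<in> carrier H \<Longrightarrow>
        tensor_maps R H 2 1 (comult H) (\<lambda>x. pure_tensor R H [x]) (comult H h) =
        tensor_maps R H 1 2 (\<lambda>x. pure_tensor R H [x]) (comult H) (comult H h)"
    and counit_left: "h \<in> carrier H \<Longrightarrow>
        tensor_lift H (\<lambda>hs. counit H (hs ! 0) \<odot>\<^bsub>H\<^esub> hs ! 1) (comult H h) = h"
    and counit_right: "h \<in> carrier H \<Longrightarrow>
        tensor_lift H (\<lambda>hs. counit H (hs ! 1) \<odot>\<^bsub>H\<^esub> hs ! 0) (comult H h) = h"
    and comult_ring_hom: "comult H \<in> ring_hom H (tensor_power R H 2)"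
    and counit_ring_hom: "counit H \<in> ring_hom H R"

definition homogeneous_decomp ::
  "('a, 'b, 'h) graded_bialgebra_scheme \<Rightarrow> 'b \<Rightarrow> (nat \<Rightarrow> 'b) \<Rightarrow> bool" where
  "homogeneous_decomp H h g \<longleftrightarrow> (\<forall>n. g n \<in> component H n) \<and> finite {n. g n \<noteq> \<zero>\<^bsub>H\<^esub>} \<and>
     h = (\<Oplus>\<^bsub>H\<^esub>n\<in>{n. g n \<noteq> \<zero>\<^bsub>H\<^esub>}. g n)"

text \<open>The degree-\<open>n\<close> part of \<open>H \<otimes> H\<close>, that is, the sum of the \<open>H\<^sub>i \<otimes> H\<^sub>j\<close> with \<open>i + j = n\<close>.\<close>

definition tensor_square_component ::
  "('a, 'r) ring_scheme \<Rightarrow> ('a, 'b, 'h) graded_bialgebra_scheme \<Rightarrow> nat \<Rightarrow> ('a, 'b) tensor set" where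
  "tensor_square_component R H n = {T \<in> carrier (tensor_power R H 2).
     \<exists>t\<in>T. \<forall>(c, hs)\<in>set t. \<exists>i j. i + j = n \<and> hs ! 0 \<in> component H i \<and> hs ! 1 \<in> component H j}"

locale graded_bialgebra = bialgebra R H
  for R :: "('a, 'r) ring_scheme" (structure)
    and H :: "('a, 'b, 'h) graded_bialgebra_scheme" (structure) +
  assumes component_submodule: "submodule (component H n) R H"
    and direct_sum: "h \<in> carrier H \<Longrightarrow> \<exists>!g. homogeneous_decomp H h g"
    and mult_graded: "\<lbrakk>x \<in> component H i; y \<in> component H j\<rbrakk> \<Longrightarrow> x \<otimes>\<^bsub>H\<^esub> y \<in> component H (i + j)"
    and one_graded: "\<one>\<^bsub>H\<^esub> \<in> component H 0"
    and comult_graded: "h \<in> component H n \<Longrightarrow> comult H h \<in> tensor_square_component R H n"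
    and counit_graded: "\<lbrakk>h \<in> component H n; n \<noteq> 0\<rbrakk> \<Longrightarrow> counit H h = \<zero>\<^bsub>R\<^esub>"


section \<open>The endomorphisms attached to a weak composition and a permutation\<close>

definition graded_proj :: "('a, 'b, 'h) graded_bialgebra_scheme \<Rightarrow> nat \<Rightarrow> 'b \<Rightarrow> 'b" where
  "graded_proj H n h = (THE g. homogeneous_decomp H h g) n"

definition iter_mult :: "('a, 'b, 'h) graded_bialgebra_scheme \<Rightarrow> ('a, 'b) tensor \<Rightarrow> 'b" where
  "iter_mult H = tensor_lift H (\<lambda>hs. foldr (\<lambda>x y. x \<otimes>\<^bsub>H\<^esub> y) hs \<one>\<^bsub>H\<^esub>)"

primrec iter_comult ::
  "('a, 'r) ring_scheme \<Rightarrow> ('a, 'b, 'h) graded_bialgebra_scheme \<Rightarrow> nat \<Rightarrow> 'b \<Rightarrow> ('a, 'b) tensor"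
where
  "iter_comult R H 0 h = counit H h \<odot>\<^bsub>tensor_power R H 0\<^esub> pure_tensor R H []"
| "iter_comult R H (Suc k) h =
     tensor_maps R H 1 k (\<lambda>x. pure_tensor R H [x]) (iter_comult R H k) (comult H h)"

definition tensor_proj ::
  "('a, 'r) ring_scheme \<Rightarrow> ('a, 'b, 'h) graded_bialgebra_scheme \<Rightarrow> nat list \<Rightarrow>
    ('a, 'b) tensor \<Rightarrow> ('a, 'b) tensor" where
  "tensor_proj R H \<alpha> =
     tensor_lift (tensor_power R H (length \<alpha>)) (\<lambda>hs. pure_tensor R H (map2 (graded_proj H) \<alpha> hs))"

definition p_endo ::
  "('a, 'r) ring_scheme \<Rightarrow> ('a, 'b, 'h) graded_bialgebra_scheme \<Rightarrow> nat list \<Rightarrow> (nat \<Rightarrow> nat) \<Rightarrow>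
    'b \<Rightarrow> 'b" where
  "p_endo R H \<alpha> \<sigma> = iter_mult H \<circ> tensor_proj R H \<alpha> \<circ>
     tensor_permute R H (length \<alpha>) (inv_into UNIV \<sigma>) \<circ> iter_comult R H (length \<alpha>)"


section \<open>The graded dual\<close>

text \<open>Linear forms are extensional functions on \<open>carrier H\<close>, so equal forms are equal functions.\<close>

definition linear_forms ::
  "('a, 'r) ring_scheme \<Rightarrow> ('a, 'b, 'm) module_scheme \<Rightarrow> ('b \<Rightarrow> 'a) set" where
  "linear_forms R M = module_hom R M (ring_as_module R) \<inter> extensional (carrier M)"

text \<open>\<open>(H\<^sub>n)\<^sup>*\<close> inside \<open>H\<^sup>*\<close>: a form on \<open>H\<^sub>n\<close> is extended by zero to the other components.\<close>

definition dual_component ::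
  "('a, 'r) ring_scheme \<Rightarrow> ('a, 'b, 'h) graded_bialgebra_scheme \<Rightarrow> nat \<Rightarrow> ('b \<Rightarrow> 'a) set" where
  "dual_component R H n =
     {f \<in> linear_forms R H. \<forall>m. m \<noteq> n \<longrightarrow> (\<forall>x\<in>component H m. f x = \<zero>\<^bsub>R\<^esub>)}"

text \<open>\<open>\<langle>f\<^sub>1 \<otimes> \<dots> \<otimes> f\<^sub>k, h\<^sub>1 \<otimes> \<dots> \<otimes> h\<^sub>k\<rangle> = f\<^sub>1(h\<^sub>1) \<cdots> f\<^sub>k(h\<^sub>k)\<close>\<close>

definition pure_pairing ::
  "('a, 'r) ring_scheme \<Rightarrow> ('b \<Rightarrow> 'a) list \<Rightarrow> 'b list \<Rightarrow> 'a" where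
  "pure_pairing R fs hs = foldr (\<lambda>a b. a \<otimes>\<^bsub>R\<^esub> b) (map2 (\<lambda>f h. f h) fs hs) \<one>\<^bsub>R\<^esub>"

definition tensor_pairing ::
  "('a, 'r) ring_scheme \<Rightarrow> ('a, 'b \<Rightarrow> 'a) tensor \<Rightarrow> ('a, 'b) tensor \<Rightarrow> 'a" where
  "tensor_pairing R F T = tensor_lift (ring_as_module R)
     (\<lambda>fs. tensor_lift (ring_as_module R) (\<lambda>hs. pure_pairing R fs hs) T) F"

definition graded_dual_algebra ::
  "('a, 'r) ring_scheme \<Rightarrow> ('a, 'b, 'h) graded_bialgebra_scheme \<Rightarrow> ('a, 'b \<Rightarrow> 'a) module" where
  "graded_dual_algebra R H = \<lparr>
     carrier = {f. \<exists>I g. finite I \<and> (\<forall>n\<in>I. g n \<in> dual_component R H n) \<and>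
       f = (\<lambda>h\<in>carrier H. \<Oplus>\<^bsub>R\<^esub>n\<in>I. g n h)},
     monoid.mult = (\<lambda>f g. \<lambda>h\<in>carrier H.
       tensor_lift (ring_as_module R) (pure_pairing R [f, g]) (comult H h)),
     one = (\<lambda>h\<in>carrier H. counit H h),
     zero = (\<lambda>h\<in>carrier H. \<zero>\<^bsub>R\<^esub>),
     add = (\<lambda>f g. \<lambda>h\<in>carrier H. f h \<oplus>\<^bsub>R\<^esub> g h),
     smult = (\<lambda>c f. \<lambda>h\<in>carrier H. c \<otimes>\<^bsub>R\<^esub> f h) \<rparr>"

text \<open>
  If all components of \<open>H\<close> are finite free, the canonical map \<open>H\<^sup>o \<otimes> H\<^sup>o \<rightarrow> (H \<otimes> H)\<^sup>*\<close> is injective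
  and its image contains \<open>f \<circ> m\<close> for every \<open>f\<close> in \<open>H\<^sup>o\<close>. The comultiplication of \<open>f\<close> is the
  preimage of \<open>f \<circ> m\<close>.
\<close>

definition graded_dual ::
  "('a, 'r) ring_scheme \<Rightarrow> ('a, 'b, 'h) graded_bialgebra_scheme \<Rightarrow>
    ('a, 'b \<Rightarrow> 'a) graded_bialgebra" where
  "graded_dual R H = module.extend (graded_dual_algebra R H)
     (graded_bialgebra.fields
       (\<lambda>f. THE F. F \<in> carrier (tensor_power R (graded_dual_algebra R H) 2) \<and>
          (\<forall>x\<in>carrier H. \<forall>y\<in>carrier H.
             tensor_pairing R F (pure_tensor R H [x, y]) = f (x \<otimes>\<^bsub>H\<^esub> y)))
       (\<lambda>f. f \<one>\<^bsub>H\<^esub>)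
       (dual_component R H))"

definition dual_map ::
  "('a, 'b, 'm) module_scheme \<Rightarrow> ('b \<Rightarrow> 'b) \<Rightarrow> ('b \<Rightarrow> 'a) \<Rightarrow> ('b \<Rightarrow> 'a)" where
  "dual_map M \<phi> f = (\<lambda>h\<in>carrier M. f (\<phi> h))"

end

theory Submission
  imports Defs
begin

text \<open>
  Write \<open>D = H\<^sup>o\<close> and \<open>\<langle>-, -\<rangle>\<close> for the pairing of \<open>D\<^sup>\<otimes>\<^sup>k\<close> with \<open>H\<^sup>\<otimes>\<^sup>k\<close>. The operations of \<open>D\<close> are adjoint
  to those of \<open>H\<close>: by induction on \<open>k\<close>, \<open>\<langle>\<Delta>\<^sup>[\<^sup>k\<^sup>] f, h\<^sub>1 \<otimes> \<dots> \<otimes> h\<^sub>k\<rangle> = f (h\<^sub>1 \<cdots> h\<^sub>k)\<close> and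
  \<open>(f\<^sub>1 \<cdots> f\<^sub>k) h = \<langle>f\<^sub>1 \<otimes> \<dots> \<otimes> f\<^sub>k, \<Delta>\<^sup>[\<^sup>k\<^sup>] h\<rangle>\<close>, while \<open>P\<^sub>\<alpha>\<close> is self-adjoint and the action of \<open>\<sigma>\<close> is
  adjoint to that of its inverse. Hence the value of \<open>p\<^bsub>\<alpha>,\<sigma>\<^esub> f\<close> at \<open>h\<close> is \<open>f\<close> applied to
  \<open>m\<^sup>[\<^sup>k\<^sup>] (\<sigma> \<cdot> P\<^sub>\<alpha> (\<Delta>\<^sup>[\<^sup>k\<^sup>] h))\<close>, and \<open>\<sigma> \<cdot> P\<^sub>\<alpha> = P\<^bsub>\<alpha>\<cdot>\<sigma>\<^sup>-\<^sup>1\<^esub> \<cdot> \<sigma>\<close>. Finite freeness is only needed to see that the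
  comultiplication of \<open>D\<close>, a definite description, is well defined: finitely many elements of \<open>D\<close>
  vanish above a common degree \<open>N\<close>, and dual bases of the components of degree at most \<open>N\<close>
  expand them.
\<close>

section \<open>Tensor powers as modules\<close>

text \<open>Tensors are congruence classes of formal sums and are hard to compare directly, so they
  are observed through product functionals: \<open>form_lift R es\<close> is the functional
  \<open>e\<^sub>1 \<otimes> ... \<otimes> e\<^sub>k\<close>, and over D the factors are the
  evaluations \<open>evals hs\<close> at points of H. The inductions over iterated operations then
  concern scalars only. Passing back from equal pairings to equal tensors over D is done in the
  second tensor power alone, where it gives the uniqueness behind the definite description. The
  commutation of \<sigma> with the projections appears not as an equation of operators but as the
  reindexing of a product in R.\<close>

lemma tuples_update:
  "\<lbrakk>hs \<in> tuples M k; x \<in> carrier M\<rbrakk> \<Longrightarrow> hs[i := x] \<in> tuples M k"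
  using set_update_subset_insert[of hs i x] by (auto simp: tuples_def)

lemma tuples_nth: "\<lbrakk>hs \<in> tuples M k; i < k\<rbrakk> \<Longrightarrow> hs ! i \<in> carrier M"
  by (auto simp: tuples_def)

lemma Nil_in_tuples [simp]: "[] \<in> tuples M 0"
  by (simp add: tuples_def)

lemma Cons_in_tuples [simp]: "x # hs \<in> tuples M (Suc k) \<longleftrightarrow> x \<in> carrier M \<and> hs \<in> tuples M k"
  by (auto simp: tuples_def)

lemma length_in_tuples: "hs \<in> tuples M k \<Longrightarrow> length hs = k"
  by (simp add: tuples_def)

lemma tuples_permute:
  "\<lbrakk>hs \<in> tuples M k; \<pi> permutes {..<k}\<rbrakk> \<Longrightarrow> permute_list \<pi> hs \<in> tuples M k"
  by (auto simp: tuples_def)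

lemma tuples_map2:
  assumes "hs \<in> tuples M k" "length \<alpha> = k" "\<And>n. p n \<in> carrier M \<rightarrow> carrier N"
  shows "map2 p \<alpha> hs \<in> tuples N k"
proof -
  have "p n x \<in> carrier N" if "(n, x) \<in> set (zip \<alpha> hs)" for n x
    using set_zip_rightD[OF that] assms(1,3) by (auto simp: tuples_def)
  then show ?thesis
    using assms by (auto simp: tuples_def)
qed

lemma formal_sums_simps [simp]:
  "[] \<in> formal_sums R M k"
  "p # t \<in> formal_sums R M k \<longleftrightarrow> fst p \<in> carrier R \<and> snd p \<in> tuples M k \<and> t \<in> formal_sums R M k"
  "s @ t \<in> formal_sums R M k \<longleftrightarrow> s \<in> formal_sums R M k \<and> t \<in> formal_sums R M k"
  by (cases p; auto simp: formal_sums_def)+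

lemma tuples_cong: "carrier M = carrier N \<Longrightarrow> tuples M k = tuples N k"
  by (simp add: tuples_def)

lemma formal_sums_cong: "carrier M = carrier N \<Longrightarrow> formal_sums R M k = formal_sums R N k"
  by (simp add: formal_sums_def tuples_def)

text \<open>The record of the graded dual is built in two stages, and its comultiplication is
  defined with tensors over the first stage. The congruence refers only to the carrier, the addition
  and the scalars, so both stages have the same tensors.\<close>

lemma tensor_eq_transfer:
  fixes M :: "('a, 'b, 'm) module_scheme" and N :: "('a, 'b, 'n) module_scheme"
  assumes "carrier M = carrier N" "add M = add N" "smult M = smult N"
    and "tensor_eq R M k s t"
  shows "tensor_eq R N k s t"
  using assms(4)
proof induction
  case (trans s t u)
  then show ?case by (blast intro: tensor_eq.trans)
qed (auto simp: assms(1-3) tuples_cong[OF assms(1)] formal_sums_cong[OF assms(1)] intro: tensor_eq.intros)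

lemma tensor_rel_cong:
  fixes M :: "('a, 'b, 'm) module_scheme" and N :: "('a, 'b, 'n) module_scheme"
  assumes "carrier M = carrier N" "add M = add N" "smult M = smult N"
  shows "tensor_rel R M k = tensor_rel R N k"
  using tensor_eq_transfer[OF assms] tensor_eq_transfer[OF assms[symmetric]]
  by (auto simp: tensor_rel_def)

lemma tensor_power_cong:
  fixes M :: "('a, 'b, 'm) module_scheme" and N :: "('a, 'b, 'n) module_scheme"
  assumes "carrier M = carrier N" "add M = add N" "smult M = smult N"
    and "monoid.mult M = monoid.mult N" "one M = one N"
  shows "tensor_power R M k = tensor_power R N k"
  unfolding tensor_power_def
  by (simp add: tensor_rel_cong[OF assms(1-3)] formal_sums_cong[OF assms(1)] assms)

abbreviation tensor_class ::
  "('a, 'r) ring_scheme \<Rightarrow> ('a, 'b, 'm) module_scheme \<Rightarrow> nat \<Rightarrow> ('a, 'b) formal_sum \<Rightarrow>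
    ('a, 'b) tensor" where
  "tensor_class R M k t \<equiv> tensor_rel R M k `` {t}"

text \<open>The action of a scalar on representatives, which \<open>tensor_power\<close> writes as a
  list comprehension.\<close>

definition formal_scale ::
  "('a, 'r) ring_scheme \<Rightarrow> 'a \<Rightarrow> ('a, 'b) formal_sum \<Rightarrow> ('a, 'b) formal_sum" where
  "formal_scale R c t = map (\<lambda>(d, hs). (c \<otimes>\<^bsub>R\<^esub> d, hs)) t"

lemma formal_scale_simps [simp]:
  "formal_scale R c [] = []"
  "formal_scale R c (p # t) = (c \<otimes>\<^bsub>R\<^esub> fst p, snd p) # formal_scale R c t"
  "formal_scale R c (s @ t) = formal_scale R c s @ formal_scale R c t"
  by (auto simp: formal_scale_def split: prod.splits)

context module
begin

lemma tensor_eq_formal_sums: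
  assumes "tensor_eq R M k s t"
  shows "s \<in> formal_sums R M k \<and> t \<in> formal_sums R M k"
  using assms by induction (auto intro: tuples_update)

lemma equiv_tensor_rel: "equiv (formal_sums R M k) (tensor_rel R M k)"
  by (rule equivI)
    (auto simp: tensor_rel_def refl_on_def sym_def trans_def
      dest: tensor_eq_formal_sums intro: tensor_eq.refl tensor_eq.sym tensor_eq.trans)

lemma tensor_class_eqI: "tensor_eq R M k s t \<Longrightarrow> tensor_class R M k s = tensor_class R M k t"
  using equiv_class_eq[OF equiv_tensor_rel] by (auto simp: tensor_rel_def)

lemma tensor_class_memD:
  assumes "T \<in> carrier (tensor_power R M k)" "t \<in> T"
  shows "t \<in> formal_sums R M k" "T = tensor_class R M k t"
proof -
  obtain s where s: "s \<in> formal_sums R M k" "T = tensor_class R M k s"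
    using assms(1) by (auto simp: tensor_power_def quotient_def)
  then have "tensor_eq R M k s t"
    using assms(2) by (simp add: tensor_rel_def)
  then show "t \<in> formal_sums R M k" "T = tensor_class R M k t"
    using s tensor_eq_formal_sums tensor_class_eqI by auto
qed

lemma tensor_class_closed [simp]:
  "t \<in> formal_sums R M k \<Longrightarrow> tensor_class R M k t \<in> carrier (tensor_power R M k)"
  by (auto simp: tensor_power_def quotient_def)

lemma tensor_class_self: "t \<in> formal_sums R M k \<Longrightarrow> t \<in> tensor_class R M k t"
  by (auto simp: tensor_rel_def intro: tensor_eq.refl)

lemma tensor_some_mem:
  assumes "T \<in> carrier (tensor_power R M k)"
  shows "(SOME t. t \<in> T) \<in> T"
proof -
  obtain s where "s \<in> formal_sums R M k" "T = tensor_class R M k s"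
    using assms by (auto simp: tensor_power_def quotient_def)
  then have "s \<in> T"
    using tensor_class_self by blast
  then show ?thesis by (rule someI)
qed

lemma tensor_classE:
  assumes "T \<in> carrier (tensor_power R M k)"
  obtains t where "t \<in> formal_sums R M k" "T = tensor_class R M k t"
  using assms tensor_some_mem tensor_class_memD by blast

lemma formal_scale_closed [simp]:
  "\<lbrakk>c \<in> carrier R; t \<in> formal_sums R M k\<rbrakk> \<Longrightarrow> formal_scale R c t \<in> formal_sums R M k"
  by (induction t) auto

text \<open>Scaling all coefficients turns each generating relation into another instance of the
  same relation. Hence the scalar multiplication of the tensor power does not depend on the
  representative.\<close>

lemma tensor_eq_scale:
  assumes "tensor_eq R M k s t" "a \<in> carrier R"
  shows "tensor_eq R M k (formal_scale R a s) (formal_scale R a t)"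
  using assms
proof induction
  case (coeff_add c d hs)
  then show ?case
    using tensor_eq.coeff_add[of "a \<otimes> c" R "a \<otimes> d" hs M k] by (simp add: R.r_distr)
next
  case (slot_add c hs i x y)
  then show ?case
    using tensor_eq.slot_add[of "a \<otimes> c" R hs M k i x y] by simp
next
  case (slot_smult c b hs i x)
  then show ?case
    using tensor_eq.slot_smult[of "a \<otimes> c" R b hs M k i x] by (simp add: R.m_assoc)
next
  case (zero hs)
  then show ?case
    using tensor_eq.zero[of hs M k R] by simp
next
  case (trans s t u)
  then show ?case by (blast intro: tensor_eq.trans)
next
  case (sym s t)
  then show ?case by (blast intro: tensor_eq.sym)
qed (auto intro: tensor_eq.refl tensor_eq.append tensor_eq.commute)

lemma tensor_add_class:
  assumes "s \<in> formal_sums R M k" "t \<in> formal_sums R M k"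
  shows "tensor_class R M k s \<oplus>\<^bsub>tensor_power R M k\<^esub> tensor_class R M k t = tensor_class R M k (s @ t)"
proof -
  have "tensor_class R M k (s' @ t') = tensor_class R M k (s @ t)"
    if "s' \<in> tensor_class R M k s" "t' \<in> tensor_class R M k t" for s' t'
    using that tensor_class_eqI[OF tensor_eq.append[of R M k s s' t t']]
    by (simp add: tensor_rel_def)
  moreover have "tensor_class R M k s \<oplus>\<^bsub>tensor_power R M k\<^esub> tensor_class R M k t =
      (\<Union>s'\<in>tensor_class R M k s. \<Union>t'\<in>tensor_class R M k t. tensor_class R M k (s' @ t'))"
    by (simp add: tensor_power_def)
  ultimately show ?thesis
    using tensor_class_self[OF assms(1)] tensor_class_self[OF assms(2)] by blast
qed

lemma tensor_smult_class:
  assumes "c \<in> carrier R" "t \<in> formal_sums R M k"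
  shows "c \<odot>\<^bsub>tensor_power R M k\<^esub> tensor_class R M k t = tensor_class R M k (formal_scale R c t)"
proof -
  have "tensor_class R M k (formal_scale R c t') = tensor_class R M k (formal_scale R c t)"
    if "t' \<in> tensor_class R M k t" for t'
    using that tensor_class_eqI[OF tensor_eq_scale[OF _ assms(1), of k t t']]
    by (simp add: tensor_rel_def)
  moreover have "c \<odot>\<^bsub>tensor_power R M k\<^esub> tensor_class R M k t =
      (\<Union>t'\<in>tensor_class R M k t. tensor_class R M k (formal_scale R c t'))"
    by (simp add: tensor_power_def formal_scale_def)
  ultimately show ?thesis
    using tensor_class_self[OF assms(2)] by blast
qed

lemma tensor_zero_class: "\<zero>\<^bsub>tensor_power R M k\<^esub> = tensor_class R M k []"
  by (simp add: tensor_power_def)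

lemmas tensor_class_simps = tensor_add_class tensor_smult_class tensor_zero_class

text \<open>The relation \<open>coeff_add\<close> splits one coefficient at a time and so produces
  the two multiples of \<open>t\<close> interleaved; \<open>commute\<close> is what sorts them into
  two contiguous blocks.\<close>

lemma tensor_eq_scale_add:
  assumes "a \<in> carrier R" "b \<in> carrier R" "t \<in> formal_sums R M k"
  shows "tensor_eq R M k (formal_scale R (a \<oplus> b) t) (formal_scale R a t @ formal_scale R b t)"
  using assms(3)
proof (induction t)
  case Nil
  then show ?case by (auto intro: tensor_eq.refl)
next
  case (Cons p t)
  let ?a = "(a \<otimes> fst p, snd p)" and ?b = "(b \<otimes> fst p, snd p)"
  let ?s = "formal_scale R a t" and ?t = "formal_scale R b t"
  have p: "?a # ?s \<in> formal_sums R M k" "?b # ?t \<in> formal_sums R M k" "fst p \<in> carrier R"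
    "snd p \<in> tuples M k"
    using Cons.prems assms by auto
  have "tensor_eq R M k [((a \<oplus> b) \<otimes> fst p, snd p)] [?a, ?b]"
    using tensor_eq.coeff_add[of "a \<otimes> fst p" R "b \<otimes> fst p" "snd p" M k] p assms
    by (simp add: R.l_distr)
  then have "tensor_eq R M k (formal_scale R (a \<oplus> b) (p # t)) ([?a, ?b] @ (?s @ ?t))"
    using tensor_eq.append Cons by fastforce
  moreover have "tensor_eq R M k ([?b] @ ?s) (?s @ [?b])"
    using p by (intro tensor_eq.commute) auto
  then have "tensor_eq R M k ([?a] @ (([?b] @ ?s) @ ?t)) ([?a] @ ((?s @ [?b]) @ ?t))"
    using p by (meson tensor_eq.append tensor_eq.refl formal_sums_simps)
  ultimately show ?case
    using tensor_eq.trans by fastforce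
qed

lemma formal_scale_scale:
  "\<lbrakk>a \<in> carrier R; b \<in> carrier R; t \<in> formal_sums R M k\<rbrakk> \<Longrightarrow>
    formal_scale R a (formal_scale R b t) = formal_scale R (a \<otimes> b) t"
  by (induction t) (auto simp: R.m_assoc)

lemma formal_scale_one: "t \<in> formal_sums R M k \<Longrightarrow> formal_scale R \<one> t = t"
  by (induction t) auto

lemma tensor_eq_scale_zero:
  "t \<in> formal_sums R M k \<Longrightarrow> tensor_eq R M k (formal_scale R \<zero> t) []"
proof (induction t)
  case (Cons p t)
  then show ?case
    using tensor_eq.append[OF tensor_eq.zero[of "snd p" M k R], of "formal_scale R \<zero> t" "[]"]
    by simp
qed (auto intro: tensor_eq.refl)

lemma module_tensor_power: "module R (tensor_power R M k)"
proof (intro moduleI abelian_groupI)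
  let ?T = "tensor_power R M k"
  show "cring R" by (rule R.is_cring)
  show "\<zero>\<^bsub>?T\<^esub> \<in> carrier ?T" by (simp add: tensor_zero_class)
  fix X Y Z assume X: "X \<in> carrier ?T" and Y: "Y \<in> carrier ?T" and Z: "Z \<in> carrier ?T"
  obtain s t u where
    *: "s \<in> formal_sums R M k" "X = tensor_class R M k s" "t \<in> formal_sums R M k"
      "Y = tensor_class R M k t" "u \<in> formal_sums R M k" "Z = tensor_class R M k u"
    using X Y Z by (metis tensor_classE)
  show "X \<oplus>\<^bsub>?T\<^esub> Y \<in> carrier ?T" "X \<oplus>\<^bsub>?T\<^esub> Y \<oplus>\<^bsub>?T\<^esub> Z = X \<oplus>\<^bsub>?T\<^esub> (Y \<oplus>\<^bsub>?T\<^esub> Z)" "\<zero>\<^bsub>?T\<^esub> \<oplus>\<^bsub>?T\<^esub> X = X"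
    using * by (simp_all add: tensor_class_simps)
  show "X \<oplus>\<^bsub>?T\<^esub> Y = Y \<oplus>\<^bsub>?T\<^esub> X"
    using * by (simp add: tensor_class_simps tensor_class_eqI tensor_eq.commute)
  \<comment> \<open>Formal sums carry no negation, so the additive inverse is the multiple by minus
    one.\<close>
  have "(\<ominus> \<one>) \<odot>\<^bsub>?T\<^esub> X \<oplus>\<^bsub>?T\<^esub> X = tensor_class R M k (formal_scale R (\<ominus> \<one> \<oplus> \<one>) s)"
    using tensor_class_eqI[OF tensor_eq_scale_add[of "\<ominus> \<one>" \<one> s k]] *
    by (simp add: tensor_class_simps formal_scale_one)
  also have "\<dots> = \<zero>\<^bsub>?T\<^esub>"
    using tensor_class_eqI[OF tensor_eq_scale_zero[of s k]] * by (simp add: R.l_neg tensor_zero_class)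
  finally have "(\<ominus> \<one>) \<odot>\<^bsub>?T\<^esub> X \<oplus>\<^bsub>?T\<^esub> X = \<zero>\<^bsub>?T\<^esub>" .
  moreover have "(\<ominus> \<one>) \<odot>\<^bsub>?T\<^esub> X \<in> carrier ?T"
    using * by (simp add: tensor_class_simps)
  ultimately show "\<exists>Y\<in>carrier ?T. Y \<oplus>\<^bsub>?T\<^esub> X = \<zero>\<^bsub>?T\<^esub>" by blast
  show "\<one> \<odot>\<^bsub>?T\<^esub> X = X"
    using * by (simp add: tensor_class_simps formal_scale_one)
  fix a b assume ab: "a \<in> carrier R" "b \<in> carrier R"
  show "a \<odot>\<^bsub>?T\<^esub> X \<in> carrier ?T" "a \<odot>\<^bsub>?T\<^esub> (X \<oplus>\<^bsub>?T\<^esub> Y) = a \<odot>\<^bsub>?T\<^esub> X \<oplus>\<^bsub>?T\<^esub> a \<odot>\<^bsub>?T\<^esub> Y"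
    "(a \<otimes> b) \<odot>\<^bsub>?T\<^esub> X = a \<odot>\<^bsub>?T\<^esub> (b \<odot>\<^bsub>?T\<^esub> X)"
    using * ab by (simp_all add: tensor_class_simps formal_scale_scale)
  show "(a \<oplus> b) \<odot>\<^bsub>?T\<^esub> X = a \<odot>\<^bsub>?T\<^esub> X \<oplus>\<^bsub>?T\<^esub> b \<odot>\<^bsub>?T\<^esub> X"
    using * ab tensor_class_eqI[OF tensor_eq_scale_add] by (simp add: tensor_class_simps)
qed

end

section \<open>Multilinear maps\<close>

lemma module_homI:
  assumes "\<And>x. x \<in> carrier M \<Longrightarrow> \<phi> x \<in> carrier N"
    and "\<And>x y. \<lbrakk>x \<in> carrier M; y \<in> carrier M\<rbrakk> \<Longrightarrow> \<phi> (x \<oplus>\<^bsub>M\<^esub> y) = \<phi> x \<oplus>\<^bsub>N\<^esub> \<phi> y"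
    and "\<And>c x. \<lbrakk>c \<in> carrier R; x \<in> carrier M\<rbrakk> \<Longrightarrow> \<phi> (c \<odot>\<^bsub>M\<^esub> x) = c \<odot>\<^bsub>N\<^esub> \<phi> x"
  shows "\<phi> \<in> module_hom R M N"
  using assms by (auto simp: module_hom_def)

lemma module_homD:
  assumes "\<phi> \<in> module_hom R M N"
  shows "x \<in> carrier M \<Longrightarrow> \<phi> x \<in> carrier N"
    and "\<lbrakk>x \<in> carrier M; y \<in> carrier M\<rbrakk> \<Longrightarrow> \<phi> (x \<oplus>\<^bsub>M\<^esub> y) = \<phi> x \<oplus>\<^bsub>N\<^esub> \<phi> y"
    and "\<lbrakk>c \<in> carrier R; x \<in> carrier M\<rbrakk> \<Longrightarrow> \<phi> (c \<odot>\<^bsub>M\<^esub> x) = c \<odot>\<^bsub>N\<^esub> \<phi> x"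
  using assms by (auto simp: module_hom_def)

lemma module_hom_compose:
  "\<lbrakk>\<phi> \<in> module_hom R M N; \<psi> \<in> module_hom R N P\<rbrakk> \<Longrightarrow> (\<lambda>x. \<psi> (\<phi> x)) \<in> module_hom R M P"
  by (intro module_homI) (simp_all add: module_homD)

lemma module_hom_zero:
  assumes "module R M" "module R N" "\<phi> \<in> module_hom R M N"
  shows "\<phi> \<zero>\<^bsub>M\<^esub> = \<zero>\<^bsub>N\<^esub>"
proof -
  interpret M: module R M by fact
  interpret N: module R N by fact
  have "\<phi> (\<zero>\<^bsub>R\<^esub> \<odot>\<^bsub>M\<^esub> \<zero>\<^bsub>M\<^esub>) = \<zero>\<^bsub>R\<^esub> \<odot>\<^bsub>N\<^esub> \<phi> \<zero>\<^bsub>M\<^esub>"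
    using assms(3) by (intro module_homD(3)) auto
  then show ?thesis
    using module_homD(1)[OF assms(3)] by simp
qed

lemma module_hom_finsum:
  assumes "module R M" "module R N" "\<phi> \<in> module_hom R M N" "g \<in> A \<rightarrow> carrier M"
  shows "\<phi> (\<Oplus>\<^bsub>M\<^esub>a\<in>A. g a) = (\<Oplus>\<^bsub>N\<^esub>a\<in>A. \<phi> (g a))"
  using assms(4)
proof (induction A rule: infinite_finite_induct)
  interpret M: module R M by fact
  interpret N: module R N by fact
  {
    \<comment> \<open>\<open>finsum\<close> over an infinite set is zero by default, and linear maps
      preserve zero.\<close>
    case (infinite A)
    then show ?case by (simp add: module_hom_zero[OF assms(1-3)])
  next
    case empty
    then show ?case by (simp add: module_hom_zero[OF assms(1-3)])
  next
    case (insert a A)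
    then show ?case
      using module_homD(1,2)[OF assms(3)] by (simp add: Pi_def)
  }
qed

lemma ring_as_module_simps [simp]:
  "carrier (ring_as_module R) = carrier R" "add (ring_as_module R) = add R"
  "zero (ring_as_module R) = zero R" "smult (ring_as_module R) = monoid.mult R"
  by (simp_all add: ring_as_module_def)

lemma finsum_ring_as_module [simp]: "finsum (ring_as_module R) = finsum R"
  by (simp add: fun_eq_iff finsum_def finprod_def)

lemma (in cring) module_ring_as_module: "module R (ring_as_module R)"
  by (intro moduleI abelian_groupI)
    (auto simp: a_ac l_distr r_distr m_assoc is_cring intro: l_neg)

text \<open>The slots are varied by list update, in the format of \<open>slot_add\<close> and
  \<open>slot_smult\<close>, so that linearity in a slot applies to these relations
  verbatim.\<close>

definition multilinear ::
  "('a, 'r) ring_scheme \<Rightarrow> ('a, 'b, 'm) module_scheme \<Rightarrow> nat \<Rightarrow> ('a, 'c, 'n) module_scheme \<Rightarrow>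
    ('b list \<Rightarrow> 'c) \<Rightarrow> bool" where
  "multilinear R M k N \<phi> \<longleftrightarrow> (\<forall>hs\<in>tuples M k. \<phi> hs \<in> carrier N) \<and>
     (\<forall>hs\<in>tuples M k. \<forall>i<k. (\<lambda>x. \<phi> (hs[i := x])) \<in> module_hom R M N)"

lemma multilinear_funcset: "multilinear R M k N \<phi> \<Longrightarrow> \<phi> \<in> tuples M k \<rightarrow> carrier N"
  by (simp add: multilinear_def)

lemma multilinear_closed: "\<lbrakk>multilinear R M k N \<phi>; hs \<in> tuples M k\<rbrakk> \<Longrightarrow> \<phi> hs \<in> carrier N"
  by (simp add: multilinear_def)

lemma multilinear_hom:
  "\<lbrakk>multilinear R M k N \<phi>; hs \<in> tuples M k; i < k\<rbrakk> \<Longrightarrow> (\<lambda>x. \<phi> (hs[i := x])) \<in> module_hom R M N"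
  by (simp add: multilinear_def)

lemma multilinear_hom_compose:
  assumes "multilinear R M k N \<phi>" "\<Lambda> \<in> module_hom R N P"
  shows "multilinear R M k P (\<lambda>hs. \<Lambda> (\<phi> hs))"
  unfolding multilinear_def
  using module_homD(1)[OF assms(2) multilinear_closed[OF assms(1)]]
    module_hom_compose[OF multilinear_hom[OF assms(1)] assms(2)]
  by simp

lemma multilinear_map2:
  assumes "multilinear R M k N \<phi>" "length \<alpha> = k" "\<And>n. p n \<in> module_hom R P M"
  shows "multilinear R P k N (\<lambda>hs. \<phi> (map2 p \<alpha> hs))"
  unfolding multilinear_def
proof (intro conjI ballI allI impI)
  fix hs i assume hs: "hs \<in> tuples P k"
  have *: "map2 p \<alpha> hs \<in> tuples M k"
    using assms(2) hs module_homD(1)[OF assms(3)] by (intro tuples_map2) auto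
  then show "\<phi> (map2 p \<alpha> hs) \<in> carrier N"
    using multilinear_closed[OF assms(1)] by blast
  assume i: "i < k"
  have "map2 p \<alpha> (hs[i := x]) = (map2 p \<alpha> hs)[i := p (\<alpha> ! i) x]" for x
    using hs i assms(2) by (intro nth_equalityI) (auto simp: tuples_def nth_list_update)
  then show "(\<lambda>x. \<phi> (map2 p \<alpha> (hs[i := x]))) \<in> module_hom R P N"
    using module_hom_compose[OF assms(3) multilinear_hom[OF assms(1) * i]] by simp
qed

section \<open>The universal property of tensor powers\<close>

context module
begin

lemma formal_eval_closed:
  assumes "module R N" "\<phi> \<in> tuples M k \<rightarrow> carrier N" "t \<in> formal_sums R M k"
  shows "formal_eval N \<phi> t \<in> carrier N"
proof -
  interpret N: module R N by fact
  show ?thesis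
    using assms(3) by (induction t) (auto simp: funcset_mem[OF assms(2)])
qed

lemma formal_eval_cong:
  assumes "\<And>hs. hs \<in> tuples M k \<Longrightarrow> \<phi> hs = \<psi> hs" "t \<in> formal_sums R M k"
  shows "formal_eval N \<phi> t = formal_eval N \<psi> t"
  using assms(2) by (induction t) (auto simp: assms(1))

lemma formal_eval_append:
  assumes "module R N" "\<phi> \<in> tuples M k \<rightarrow> carrier N"
    and "s \<in> formal_sums R M k" "t \<in> formal_sums R M k"
  shows "formal_eval N \<phi> (s @ t) = formal_eval N \<phi> s \<oplus>\<^bsub>N\<^esub> formal_eval N \<phi> t"
proof -
  interpret N: module R N by fact
  show ?thesis
    using assms(3,4)
    by (induction s) (auto simp: funcset_mem[OF assms(2)] N.a_assoc formal_eval_closed[OF assms(1,2)])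
qed

lemma formal_eval_scale:
  assumes "module R N" "\<phi> \<in> tuples M k \<rightarrow> carrier N"
    and "t \<in> formal_sums R M k" "c \<in> carrier R"
  shows "formal_eval N \<phi> (formal_scale R c t) = c \<odot>\<^bsub>N\<^esub> formal_eval N \<phi> t"
proof -
  interpret N: module R N by fact
  show ?thesis
    using assms(3,4)
    by (induction t)
      (auto simp: funcset_mem[OF assms(2)] N.smult_assoc1 N.smult_r_distr formal_eval_closed[OF assms(1,2)])
qed

lemma hom_formal_eval:
  assumes "module R N" "module R P" "\<Lambda> \<in> module_hom R N P"
    and "\<phi> \<in> tuples M k \<rightarrow> carrier N" "t \<in> formal_sums R M k"
  shows "\<Lambda> (formal_eval N \<phi> t) = formal_eval P (\<lambda>hs. \<Lambda> (\<phi> hs)) t"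
proof -
  interpret N: module R N by fact
  show ?thesis
    using assms(5)
    by (induction t)
      (simp_all add: funcset_mem[OF assms(4)] module_hom_zero[OF assms(1-3)] module_homD(2,3)[OF assms(3)]
        formal_eval_closed[OF assms(1,4)])
qed

text \<open>This is what makes lifts well defined: the module axioms of \<open>N\<close> take care
  of the rules that present the free module, and multilinearity of \<open>\<phi>\<close> takes care
  of the last two.\<close>

lemma formal_eval_tensor_eq:
  assumes "module R N" "multilinear R M k N \<phi>" "tensor_eq R M k s t"
  shows "formal_eval N \<phi> s = formal_eval N \<phi> t"
  using assms(3)
proof induction
  interpret N: module R N by fact
  note closed = multilinear_closed[OF assms(2)] and funcset = multilinear_funcset[OF assms(2)]
  {
    case (append s s' t t')
    then show ?case
      using tensor_eq_formal_sums by (simp add: formal_eval_append[OF assms(1) funcset])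
  next
    case (commute s t)
    then show ?case
      using formal_eval_closed[OF assms(1) funcset]
      by (simp add: formal_eval_append[OF assms(1) funcset] N.a_comm)
  next
    case (coeff_add c d hs)
    then show ?case
      using closed[of hs] by (simp add: N.smult_l_distr)
  next
    case (zero hs)
    then show ?case
      using closed[of hs] by simp
  next
    case (slot_add c hs i x y)
    then show ?case
      using module_homD(1,2)[OF multilinear_hom[OF assms(2), of hs i]] by (simp add: N.smult_r_distr)
  next
    case (slot_smult c a hs i x)
    then show ?case
      using module_homD(1,3)[OF multilinear_hom[OF assms(2), of hs i]] by (simp add: N.smult_assoc1)
  }
qed simp_all

lemma tensor_some_formal_sum:
  "T \<in> carrier (tensor_power R M k) \<Longrightarrow> (SOME t. t \<in> T) \<in> formal_sums R M k"
  using tensor_class_memD(1) tensor_some_mem by blast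

lemma tensor_lift_closed:
  assumes "module R N" "\<phi> \<in> tuples M k \<rightarrow> carrier N"
    and "T \<in> carrier (tensor_power R M k)"
  shows "tensor_lift N \<phi> T \<in> carrier N"
  unfolding tensor_lift_def
  using formal_eval_closed[OF assms(1,2)] tensor_some_formal_sum[OF assms(3)] by blast

lemma tensor_lift_cong:
  assumes "\<And>hs. hs \<in> tuples M k \<Longrightarrow> \<phi> hs = \<psi> hs" "T \<in> carrier (tensor_power R M k)"
  shows "tensor_lift N \<phi> T = tensor_lift N \<psi> T"
  unfolding tensor_lift_def using formal_eval_cong[OF assms(1) tensor_some_formal_sum[OF assms(2)]] .

text \<open>Both sides evaluate the one representative chosen from \<open>T\<close>, so the identity
  follows term by term from the linearity of \<open>\<Lambda>\<close>.\<close>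

lemma hom_tensor_lift:
  assumes "module R N" "module R P" "\<Lambda> \<in> module_hom R N P"
    and "\<phi> \<in> tuples M k \<rightarrow> carrier N" "T \<in> carrier (tensor_power R M k)"
  shows "\<Lambda> (tensor_lift N \<phi> T) = tensor_lift P (\<lambda>hs. \<Lambda> (\<phi> hs)) T"
  unfolding tensor_lift_def
  using hom_formal_eval[OF assms(1-4) tensor_some_formal_sum[OF assms(5)]] .

lemma tensor_lift_class:
  assumes "module R N" "multilinear R M k N \<phi>" "t \<in> formal_sums R M k"
  shows "tensor_lift N \<phi> (tensor_class R M k t) = formal_eval N \<phi> t"
proof -
  have "tensor_eq R M k t (SOME s. s \<in> tensor_class R M k t)"
    using tensor_some_mem[OF tensor_class_closed[OF assms(3)]] by (simp add: tensor_rel_def)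
  then show ?thesis
    unfolding tensor_lift_def using formal_eval_tensor_eq[OF assms(1,2)] by simp
qed

lemma tensor_lift_hom:
  assumes "module R N" "multilinear R M k N \<phi>"
  shows "tensor_lift N \<phi> \<in> module_hom R (tensor_power R M k) N"
proof (rule module_homI)
  note closed = multilinear_funcset[OF assms(2)]
  fix S T c assume "S \<in> carrier (tensor_power R M k)"
  then obtain s where s: "s \<in> formal_sums R M k" "S = tensor_class R M k s"
    by (rule tensor_classE)
  show "tensor_lift N \<phi> S \<in> carrier N"
    using s tensor_lift_closed[OF assms(1) closed] by simp
  show "tensor_lift N \<phi> (c \<odot>\<^bsub>tensor_power R M k\<^esub> S) = c \<odot>\<^bsub>N\<^esub> tensor_lift N \<phi> S" if "c \<in> carrier R"
    using s that formal_eval_scale[OF assms(1) closed]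
    by (simp add: tensor_smult_class tensor_lift_class[OF assms])
  assume "T \<in> carrier (tensor_power R M k)"
  then obtain t where t: "t \<in> formal_sums R M k" "T = tensor_class R M k t"
    by (rule tensor_classE)
  show "tensor_lift N \<phi> (S \<oplus>\<^bsub>tensor_power R M k\<^esub> T) = tensor_lift N \<phi> S \<oplus>\<^bsub>N\<^esub> tensor_lift N \<phi> T"
    using s t formal_eval_append[OF assms(1) closed]
    by (simp add: tensor_add_class tensor_lift_class[OF assms])
qed

lemma pure_tensor_class: "hs \<in> tuples M k \<Longrightarrow> pure_tensor R M hs = tensor_class R M k [(\<one>, hs)]"
  by (simp add: pure_tensor_def tuples_def)

lemma pure_tensor_closed: "hs \<in> tuples M k \<Longrightarrow> pure_tensor R M hs \<in> carrier (tensor_power R M k)"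
  by (simp add: pure_tensor_class)

lemma tensor_lift_pure:
  assumes "module R N" "multilinear R M k N \<phi>" "hs \<in> tuples M k"
  shows "tensor_lift N \<phi> (pure_tensor R M hs) = \<phi> hs"
proof -
  interpret N: module R N by fact
  show ?thesis
    using assms multilinear_closed[OF assms(2,3)] by (simp add: pure_tensor_class tensor_lift_class)
qed

text \<open>The relations \<open>slot_add\<close> and \<open>slot_smult\<close> were imposed for
  this. It later allows a sum to be expanded inside one factor of a pure tensor.\<close>

lemma multilinear_pure_tensor: "multilinear R M k (tensor_power R M k) (pure_tensor R M)"
  unfolding multilinear_def
proof (intro conjI ballI allI impI module_homI)
  fix hs i x y c assume hs: "hs \<in> tuples M k"
  then show "pure_tensor R M hs \<in> carrier (tensor_power R M k)" by (rule pure_tensor_closed)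
  assume *: "i < k" "x \<in> carrier M"
  then show "pure_tensor R M (hs[i := x]) \<in> carrier (tensor_power R M k)"
    using hs by (simp add: pure_tensor_closed tuples_update)
  show "pure_tensor R M (hs[i := c \<odot>\<^bsub>M\<^esub> x]) = c \<odot>\<^bsub>tensor_power R M k\<^esub> pure_tensor R M (hs[i := x])"
    if "c \<in> carrier R"
    using * hs that tensor_class_eqI[OF tensor_eq.slot_smult[of \<one> R c hs M k i x]]
    by (simp add: pure_tensor_class[of _ k] tuples_update tensor_smult_class)
  assume "y \<in> carrier M"
  then show "pure_tensor R M (hs[i := x \<oplus>\<^bsub>M\<^esub> y]) =
      pure_tensor R M (hs[i := x]) \<oplus>\<^bsub>tensor_power R M k\<^esub> pure_tensor R M (hs[i := y])"
    using * hs tensor_class_eqI[OF tensor_eq.slot_add[of \<one> R hs M k i x y]]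
    by (simp add: pure_tensor_class[of _ k] tuples_update tensor_add_class)
qed

end

text \<open>A lift after a lift: the outer one is linear, so it moves inside the inner one and is
  evaluated there on pure tensors. The same pattern serves the projections.\<close>

lemma tensor_lift_permute:
  fixes M :: "('a, 'b, 'm) module_scheme"
  assumes "module R M" "module R N" "multilinear R M k N \<phi>" "\<pi> permutes {..<k}"
    and "T \<in> carrier (tensor_power R M k)"
  shows "tensor_permute R M k \<pi> T \<in> carrier (tensor_power R M k)"
    and "tensor_lift N \<phi> (tensor_permute R M k \<pi> T) =
      tensor_lift N (\<lambda>hs. \<phi> (permute_list (inv_into UNIV \<pi>) hs)) T"
proof -
  interpret module R M by fact
  note perm = tuples_permute[OF _ permutes_inv[OF assms(4)]]
  have closed: "(\<lambda>hs. pure_tensor R M (permute_list (inv_into UNIV \<pi>) hs)) \<in>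
      tuples M k \<rightarrow> carrier (tensor_power R M k)"
    using pure_tensor_closed[OF perm] by blast
  show "tensor_permute R M k \<pi> T \<in> carrier (tensor_power R M k)"
    unfolding tensor_permute_def
    using tensor_lift_closed[OF module_tensor_power closed assms(5)] .
  show "tensor_lift N \<phi> (tensor_permute R M k \<pi> T) =
      tensor_lift N (\<lambda>hs. \<phi> (permute_list (inv_into UNIV \<pi>) hs)) T"
    unfolding tensor_permute_def
    using hom_tensor_lift[OF module_tensor_power assms(2) tensor_lift_hom[OF assms(2,3)] closed assms(5)]
      tensor_lift_pure[OF assms(2,3) perm] assms(5)
    by (auto intro: tensor_lift_cong)
qed

lemma tensor_lift_proj:
  fixes M :: "('a, 'b, 'm) graded_bialgebra_scheme"
  assumes "module R M" "module R N" "multilinear R M k N \<phi>" "length \<alpha> = k"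
    and "\<And>n. graded_proj M n \<in> module_hom R M M" "T \<in> carrier (tensor_power R M k)"
  shows "tensor_proj R M \<alpha> T \<in> carrier (tensor_power R M k)"
    and "tensor_lift N \<phi> (tensor_proj R M \<alpha> T) =
      tensor_lift N (\<lambda>hs. \<phi> (map2 (graded_proj M) \<alpha> hs)) T"
proof -
  interpret module R M by fact
  have proj: "map2 (graded_proj M) \<alpha> hs \<in> tuples M k" if "hs \<in> tuples M k" for hs
    using that assms(4) module_homD(1)[OF assms(5)] by (intro tuples_map2) auto
  have closed: "(\<lambda>hs. pure_tensor R M (map2 (graded_proj M) \<alpha> hs)) \<in>
      tuples M k \<rightarrow> carrier (tensor_power R M k)"
    using pure_tensor_closed[OF proj] by blast
  show "tensor_proj R M \<alpha> T \<in> carrier (tensor_power R M k)"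
    unfolding tensor_proj_def assms(4)
    using tensor_lift_closed[OF module_tensor_power closed assms(6)] .
  show "tensor_lift N \<phi> (tensor_proj R M \<alpha> T) =
      tensor_lift N (\<lambda>hs. \<phi> (map2 (graded_proj M) \<alpha> hs)) T"
    unfolding tensor_proj_def assms(4)
    using hom_tensor_lift[OF module_tensor_power assms(2) tensor_lift_hom[OF assms(2,3)] closed assms(6)]
      tensor_lift_pure[OF assms(2,3) proj] assms(6)
    by (auto intro: tensor_lift_cong)
qed

text \<open>The tensor is permuted first, so in the pullback the permutation stands innermost. Since
  the projections are linear, the map pulled back along them is again multilinear, as the
  permutation step requires.\<close>

lemma tensor_lift_proj_permute:
  fixes M :: "('a, 'b, 'm) graded_bialgebra_scheme"
  assumes "module R M" "module R N" "multilinear R M k N \<phi>" "length \<alpha> = k" "\<pi> permutes {..<k}"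
    and "\<And>n. graded_proj M n \<in> module_hom R M M" "T \<in> carrier (tensor_power R M k)"
  shows "tensor_proj R M \<alpha> (tensor_permute R M k \<pi> T) \<in> carrier (tensor_power R M k)"
    and "tensor_lift N \<phi> (tensor_proj R M \<alpha> (tensor_permute R M k \<pi> T)) =
      tensor_lift N (\<lambda>hs. \<phi> (map2 (graded_proj M) \<alpha> (permute_list (inv_into UNIV \<pi>) hs))) T"
proof -
  note perm = tensor_lift_permute[OF assms(1,2) multilinear_map2[OF assms(3,4,6)] assms(5,7)]
  note proj = tensor_lift_proj[OF assms(1-4,6) perm(1)]
  show "tensor_proj R M \<alpha> (tensor_permute R M k \<pi> T) \<in> carrier (tensor_power R M k)"
    by (rule proj(1))
  show "tensor_lift N \<phi> (tensor_proj R M \<alpha> (tensor_permute R M k \<pi> T)) =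
      tensor_lift N (\<lambda>hs. \<phi> (map2 (graded_proj M) \<alpha> (permute_list (inv_into UNIV \<pi>) hs))) T"
    unfolding proj(2) perm(2) ..
qed

subsection \<open>Pairings with linear forms\<close>

lemma pure_pairing_simps [simp]:
  "pure_pairing R [] [] = \<one>\<^bsub>R\<^esub>"
  "pure_pairing R (e # es) (h # hs) = e h \<otimes>\<^bsub>R\<^esub> pure_pairing R es hs"
  by (simp_all add: pure_pairing_def)

abbreviation form_lift ::
  "('a, 'r) ring_scheme \<Rightarrow> ('b \<Rightarrow> 'a) list \<Rightarrow> ('a, 'b) tensor \<Rightarrow> 'a" where
  "form_lift R es \<equiv> tensor_lift (ring_as_module R) (pure_pairing R es)"

context module
begin

abbreviation forms :: "('c \<Rightarrow> 'a) set" where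
  "forms \<equiv> module_hom R M (ring_as_module R)"

lemma module_R: "module R (ring_as_module R)"
  by (rule R.module_ring_as_module)

lemma pure_pairing_closed:
  "\<lbrakk>set es \<subseteq> forms; hs \<in> tuples M (length es)\<rbrakk> \<Longrightarrow> pure_pairing R es hs \<in> carrier R"
proof (induction es arbitrary: hs)
  case (Cons e es)
  then show ?case
    by (cases hs) (auto simp: tuples_def dest: module_homD(1))
qed (auto simp: tuples_def)

lemma multilinear_pure_pairing:
  assumes "set es \<subseteq> forms"
  shows "multilinear R M (length es) (ring_as_module R) (pure_pairing R es)"
proof -
  have "(\<lambda>x. pure_pairing R es (hs[i := x])) \<in> forms"
    if "hs \<in> tuples M (length es)" "i < length es" for hs i
    using assms that
  proof (induction es arbitrary: hs i)
    case (Cons e es)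
    then obtain h hs' where hs: "hs = h # hs'" "h \<in> carrier M" "hs' \<in> tuples M (length es)"
      by (cases hs) (auto simp: tuples_def)
    have e: "e \<in> forms" and es: "set es \<subseteq> forms"
      using Cons.prems by auto
    note e_simps = module_homD[OF e, simplified]
    show ?case
    proof (cases i)
      case 0
      then show ?thesis
        using pure_pairing_closed[OF es hs(3)]
        by (intro module_homI) (auto simp: hs e_simps R.l_distr R.m_assoc)
    next
      case (Suc j)
      then have "(\<lambda>x. pure_pairing R es (hs'[j := x])) \<in> forms"
        using Cons hs by auto
      note IH = module_homD[OF this, simplified]
      show ?thesis
        using Suc hs(2)
        by (intro module_homI) (auto simp: hs(1) IH e_simps R.r_distr R.m_lcomm)
    qed
  qed simp
  then show ?thesis
    using pure_pairing_closed[OF assms] by (auto simp: multilinear_def)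
qed

lemma form_lift_hom:
  "set es \<subseteq> forms \<Longrightarrow>
    form_lift R es \<in> module_hom R (tensor_power R M (length es)) (ring_as_module R)"
  using tensor_lift_hom[OF module_R multilinear_pure_pairing] .

lemma form_lift_pure:
  "\<lbrakk>set es \<subseteq> forms; hs \<in> tuples M (length es)\<rbrakk> \<Longrightarrow>
    form_lift R es (pure_tensor R M hs) = pure_pairing R es hs"
  using tensor_lift_pure[OF module_R multilinear_pure_pairing] .

lemma form_lift_closed:
  "\<lbrakk>set es \<subseteq> forms; T \<in> carrier (tensor_power R M (length es))\<rbrakk> \<Longrightarrow> form_lift R es T \<in> carrier R"
  using module_homD(1)[OF form_lift_hom] by auto

lemma pure_pairing_append:
  "\<lbrakk>set es \<subseteq> forms; set fs \<subseteq> forms; hs \<in> tuples M (length es); ks \<in> tuples M (length fs)\<rbrakk> \<Longrightarrow>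
    pure_pairing R (es @ fs) (hs @ ks) = pure_pairing R es hs \<otimes> pure_pairing R fs ks"
proof (induction es arbitrary: hs)
  case Nil
  then show ?case
    using pure_pairing_closed by (auto simp: tuples_def)
next
  case (Cons e es)
  then obtain h hs' where hs: "hs = h # hs'" "h \<in> carrier M" "hs' \<in> tuples M (length es)"
    by (cases hs) (auto simp: tuples_def)
  then show ?case
    using Cons pure_pairing_closed[of es hs'] pure_pairing_closed[of fs ks]
    by (auto simp: R.m_assoc dest: module_homD(1))
qed

lemma scale_hom: "a \<in> carrier R \<Longrightarrow> (\<lambda>x. a \<otimes> x) \<in> module_hom R (ring_as_module R) (ring_as_module R)"
  by (intro module_homI) (auto simp: R.r_distr R.m_lcomm)

lemma tensor_lift_mult:
  assumes "a \<in> carrier R" "\<phi> \<in> tuples M k \<rightarrow> carrier R"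
    and "T \<in> carrier (tensor_power R M k)"
  shows "tensor_lift (ring_as_module R) (\<lambda>hs. a \<otimes> \<phi> hs) T = a \<otimes> tensor_lift (ring_as_module R) \<phi> T"
  using hom_tensor_lift[OF module_R module_R scale_hom[OF assms(1)]] assms(2,3) by simp

section \<open>Concatenation of tensors and the recursion step of iterated comultiplications\<close>

lemma tuples_append:
  "\<lbrakk>hs \<in> tuples M k; ks \<in> tuples M l\<rbrakk> \<Longrightarrow> hs @ ks \<in> tuples M (k + l)"
  by (auto simp: tuples_def)

lemma tensor_concat_closed:
  assumes "S \<in> carrier (tensor_power R M k)" "T \<in> carrier (tensor_power R M l)"
  shows "tensor_concat R M k l S T \<in> carrier (tensor_power R M (k + l))"
  unfolding tensor_concat_def
  using assms
  by (intro tensor_lift_closed[OF module_tensor_power] funcsetI pure_tensor_closed tuples_append)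

text \<open>On pure tensors this is \<open>pure_pairing_append\<close>. The functional passes
  through the two nested lifts of \<open>tensor_concat\<close>, and at each level the factor that is
  constant in the current variable is pulled out.\<close>

lemma form_lift_concat:
  assumes "set es \<subseteq> forms" "set fs \<subseteq> forms"
    and S: "S \<in> carrier (tensor_power R M (length es))"
    and T: "T \<in> carrier (tensor_power R M (length fs))"
  shows "form_lift R (es @ fs) (tensor_concat R M (length es) (length fs) S T) =
    form_lift R es S \<otimes> form_lift R fs T"
proof -
  let ?T = "tensor_power R M (length es + length fs)"
  note forms = assms(1,2)
  have hom: "form_lift R (es @ fs) \<in> module_hom R ?T (ring_as_module R)"
    using form_lift_hom[of "es @ fs"] forms by simp
  have pure: "pure_tensor R M (hs @ ks) \<in> carrier ?T"
    if "hs \<in> tuples M (length es)" "ks \<in> tuples M (length fs)" for hs ks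
    using that by (intro pure_tensor_closed tuples_append)
  \<comment> \<open>The inner lift is evaluated for a fixed left tuple. The factors are then
    exchanged so that the scalar that is constant for the outer lift stands on the left, as in
    \<open>tensor_lift_mult\<close>.\<close>
  have inner: "form_lift R (es @ fs) (tensor_lift ?T (\<lambda>ks. pure_tensor R M (hs @ ks)) T) =
      form_lift R fs T \<otimes> pure_pairing R es hs" if hs: "hs \<in> tuples M (length es)" for hs
  proof -
    have "form_lift R (es @ fs) (tensor_lift ?T (\<lambda>ks. pure_tensor R M (hs @ ks)) T) =
        tensor_lift (ring_as_module R) (\<lambda>ks. form_lift R (es @ fs) (pure_tensor R M (hs @ ks))) T"
      using pure[OF hs] by (intro hom_tensor_lift[OF module_tensor_power module_R hom _ T]) blast
    also have "\<dots> = tensor_lift (ring_as_module R) (\<lambda>ks. pure_pairing R es hs \<otimes> pure_pairing R fs ks) T"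
      using forms hs tuples_append[OF hs]
      by (intro tensor_lift_cong[OF _ T]) (simp add: form_lift_pure pure_pairing_append)
    also have "\<dots> = pure_pairing R es hs \<otimes> form_lift R fs T"
      using forms hs T by (intro tensor_lift_mult funcsetI pure_pairing_closed)
    finally show ?thesis
      using forms hs T by (simp add: R.m_comm pure_pairing_closed form_lift_closed)
  qed
  have "form_lift R (es @ fs) (tensor_concat R M (length es) (length fs) S T) =
      tensor_lift (ring_as_module R)
        (\<lambda>hs. form_lift R (es @ fs) (tensor_lift ?T (\<lambda>ks. pure_tensor R M (hs @ ks)) T)) S"
    unfolding tensor_concat_def
    using pure T S
    by (intro hom_tensor_lift[OF module_tensor_power module_R hom] funcsetI
        tensor_lift_closed[OF module_tensor_power]) auto
  also have "\<dots> = tensor_lift (ring_as_module R) (\<lambda>hs. form_lift R fs T \<otimes> pure_pairing R es hs) S"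
    using inner by (intro tensor_lift_cong[OF _ S])
  also have "\<dots> = form_lift R fs T \<otimes> form_lift R es S"
    using forms S T by (intro tensor_lift_mult form_lift_closed funcsetI pure_pairing_closed)
  finally show ?thesis
    using forms S T by (simp add: R.m_comm form_lift_closed)
qed

text \<open>One step of \<open>iter_comult\<close> seen through a product functional. It is stated
  for an arbitrary module and an arbitrary \<open>\<psi>\<close> so that it serves both H and its
  graded dual.\<close>

lemma tensor_maps_Suc:
  assumes "\<And>x. x \<in> carrier M \<Longrightarrow> \<psi> x \<in> carrier (tensor_power R M k)"
    and T: "T \<in> carrier (tensor_power R M 2)"
  shows "tensor_maps R M 1 k (\<lambda>x. pure_tensor R M [x]) \<psi> T \<in> carrier (tensor_power R M (Suc k))"
    and "\<lbrakk>e \<in> forms; set fs \<subseteq> forms; length fs = k\<rbrakk> \<Longrightarrow>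
      form_lift R (e # fs) (tensor_maps R M 1 k (\<lambda>x. pure_tensor R M [x]) \<psi> T) =
      tensor_lift (ring_as_module R) (\<lambda>hs. e (hs ! 0) \<otimes> form_lift R fs (\<psi> (hs ! 1))) T"
proof -
  have pure: "pure_tensor R M [hs ! 0] \<in> carrier (tensor_power R M 1)" "hs ! 0 \<in> carrier M"
    "\<psi> (hs ! 1) \<in> carrier (tensor_power R M k)" if "hs \<in> tuples M 2" for hs
    using tuples_nth[OF that] assms(1) pure_tensor_closed[of "[hs ! 0]" 1] by auto
  have closed: "(\<lambda>hs. tensor_concat R M 1 k (pure_tensor R M [hs ! 0]) (\<psi> (hs ! 1))) \<in>
      tuples M 2 \<rightarrow> carrier (tensor_power R M (1 + k))"
    using tensor_concat_closed[OF pure(1,3)] by blast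
  show "tensor_maps R M 1 k (\<lambda>x. pure_tensor R M [x]) \<psi> T \<in> carrier (tensor_power R M (Suc k))"
    unfolding tensor_maps_def
    using tensor_lift_closed[OF module_tensor_power closed T] by simp
  assume *: "e \<in> forms" "set fs \<subseteq> forms" "length fs = k"
  then have hom: "form_lift R (e # fs) \<in> module_hom R (tensor_power R M (1 + k)) (ring_as_module R)"
    using form_lift_hom[of "e # fs"] by simp
  have "form_lift R (e # fs) (tensor_maps R M 1 k (\<lambda>x. pure_tensor R M [x]) \<psi> T) =
      tensor_lift (ring_as_module R) (\<lambda>hs. form_lift R (e # fs)
        (tensor_concat R M 1 k (pure_tensor R M [hs ! 0]) (\<psi> (hs ! 1)))) T"
    unfolding tensor_maps_def
    using hom_tensor_lift[OF module_tensor_power module_R hom closed T] .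
  also have "\<dots> = tensor_lift (ring_as_module R) (\<lambda>hs. e (hs ! 0) \<otimes> form_lift R fs (\<psi> (hs ! 1))) T"
  proof (rule tensor_lift_cong[OF _ T])
    fix hs assume hs: "hs \<in> tuples M 2"
    then show "form_lift R (e # fs) (tensor_concat R M 1 k (pure_tensor R M [hs ! 0]) (\<psi> (hs ! 1))) =
        e (hs ! 0) \<otimes> form_lift R fs (\<psi> (hs ! 1))"
      using form_lift_concat[of "[e]" fs "pure_tensor R M [hs ! 0]" "\<psi> (hs ! 1)"]
        form_lift_pure[of "[e]" "[hs ! 0]"] pure[OF hs] * module_homD(1)[OF *(1) pure(2)[OF hs]]
      by simp
  qed
  finally show "form_lift R (e # fs) (tensor_maps R M 1 k (\<lambda>x. pure_tensor R M [x]) \<psi> T) =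
      tensor_lift (ring_as_module R) (\<lambda>hs. e (hs ! 0) \<otimes> form_lift R fs (\<psi> (hs ! 1))) T" .
qed

end

lemma (in abelian_monoid) finsum_Sigma:
  assumes "finite A" "\<And>a. a \<in> A \<Longrightarrow> finite (B a)" "g \<in> Sigma A B \<rightarrow> carrier G"
  shows "(\<Oplus>p\<in>Sigma A B. g p) = (\<Oplus>a\<in>A. \<Oplus>b\<in>B a. g (a, b))"
proof -
  have "Sigma A B = (\<Union>a\<in>A. Pair a ` B a)" by auto
  moreover have "(\<Oplus>p\<in>Pair a ` B a. g p) = (\<Oplus>b\<in>B a. g (a, b))" if "a \<in> A" for a
    using that assms(3) by (intro finsum_reindex) (auto simp: inj_on_def)
  moreover have closed: "g (a, b) \<in> carrier G" if "a \<in> A" "b \<in> B a" for a b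
    using that assms(3) by auto
  moreover have "(\<Oplus>p\<in>(\<Union>a\<in>A. Pair a ` B a). g p) = (\<Oplus>a\<in>A. \<Oplus>p\<in>Pair a ` B a. g p)"
    using assms by (intro add.finprod_UN_disjoint) (auto simp: pairwise_def disjnt_def)
  ultimately show ?thesis
    by (auto intro!: finsum_cong' finsum_closed)
qed

section \<open>Iterated operations of a bialgebra\<close>

context bialgebra
begin

lemma prod_list_closed:
  "hs \<in> tuples H k \<Longrightarrow> foldr (\<lambda>x y. x \<otimes>\<^bsub>H\<^esub> y) hs \<one>\<^bsub>H\<^esub> \<in> carrier H"
proof (induction hs arbitrary: k)
  case (Cons h hs)
  then show ?case by (cases k) (auto simp: tuples_def)
qed simp

lemma multilinear_prod_list:
  "multilinear R H k H (\<lambda>hs. foldr (\<lambda>x y. x \<otimes>\<^bsub>H\<^esub> y) hs \<one>\<^bsub>H\<^esub>)"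
proof -
  have "(\<lambda>x. foldr (\<lambda>x y. x \<otimes>\<^bsub>H\<^esub> y) (hs[i := x]) \<one>\<^bsub>H\<^esub>) \<in> module_hom R H H"
    if "hs \<in> tuples H k" "i < k" for hs i
    using that
  proof (induction hs arbitrary: k i)
    case (Cons h hs)
    then obtain l where l: "k = Suc l" "h \<in> carrier H" "hs \<in> tuples H l"
      by (cases k) (auto simp: tuples_def)
    show ?case
    proof (cases i)
      case 0
      then show ?thesis
        using prod_list_closed[OF l(3)]
        by (intro module_homI) (auto simp: l_distr smult_mult_left)
    next
      case (Suc j)
      then have "(\<lambda>x. foldr (\<lambda>x y. x \<otimes>\<^bsub>H\<^esub> y) (hs[j := x]) \<one>\<^bsub>H\<^esub>) \<in> module_hom R H H"
        using Cons l by auto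
      note IH = module_homD[OF this]
      show ?thesis
        using Suc l(2) by (intro module_homI) (auto simp: IH r_distr smult_mult_right)
    qed
  qed (simp add: tuples_def)
  then show ?thesis
    using prod_list_closed by (auto simp: multilinear_def)
qed

lemma comult_closed: "h \<in> carrier H \<Longrightarrow> comult H h \<in> carrier (tensor_power R H 2)"
  using module_homD(1)[OF comult_linear] .

lemma counit_closed: "h \<in> carrier H \<Longrightarrow> counit H h \<in> carrier R"
  using module_homD(1)[OF counit_linear] by simp

lemma iter_comult_closed: "h \<in> carrier H \<Longrightarrow> iter_comult R H k h \<in> carrier (tensor_power R H k)"
proof (induction k arbitrary: h)
  case 0
  then show ?case
    using module.smult_closed[OF module_tensor_power] pure_tensor_closed[of "[]" 0] counit_closed
    by simp
next
  case (Suc k)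
  then show ?case
    using tensor_maps_Suc(1)[OF Suc.IH comult_closed] by simp
qed

lemma form_lift_iter_comult_0: "h \<in> carrier H \<Longrightarrow> form_lift R [] (iter_comult R H 0 h) = counit H h"
  using module_homD(3)[OF form_lift_hom[of "[]"], of "counit H h" "pure_tensor R H []"]
    form_lift_pure[of "[]" "[]"] pure_tensor_closed[of "[]" 0] counit_closed
  by simp

lemma form_lift_iter_comult_Suc:
  assumes "h \<in> carrier H" "e \<in> forms" "set fs \<subseteq> forms"
  shows "form_lift R (e # fs) (iter_comult R H (Suc (length fs)) h) =
    tensor_lift (ring_as_module R)
      (\<lambda>hs. e (hs ! 0) \<otimes>\<^bsub>R\<^esub> form_lift R fs (iter_comult R H (length fs) (hs ! 1))) (comult H h)"
  using tensor_maps_Suc(2)[OF iter_comult_closed comult_closed[OF assms(1)] assms(2,3)] by simp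

text \<open>Both \<open>foldr\<close> and \<open>iter_comult\<close> split off the leftmost factor
  and recurse on the rest, so the two recursions agree step by step.\<close>

lemma convolution_prod_list:
  assumes "set fs \<subseteq> forms" "h \<in> carrier H"
  shows "foldr (\<lambda>f g. f \<otimes>\<^bsub>graded_dual_algebra R H\<^esub> g) fs \<one>\<^bsub>graded_dual_algebra R H\<^esub> h =
    form_lift R fs (iter_comult R H (length fs) h)"
  using assms
proof (induction fs arbitrary: h)
  case Nil
  then show ?case
    using form_lift_iter_comult_0[OF Nil(2)] by (simp add: graded_dual_algebra_def)
next
  case (Cons e fs)
  let ?g = "foldr (\<lambda>f g. f \<otimes>\<^bsub>graded_dual_algebra R H\<^esub> g) fs \<one>\<^bsub>graded_dual_algebra R H\<^esub>"
  have "foldr (\<lambda>f g. f \<otimes>\<^bsub>graded_dual_algebra R H\<^esub> g) (e # fs) \<one>\<^bsub>graded_dual_algebra R H\<^esub> h =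
      tensor_lift (ring_as_module R) (pure_pairing R [e, ?g]) (comult H h)"
    using Cons.prems(2) by (simp add: graded_dual_algebra_def)
  also have "\<dots> = tensor_lift (ring_as_module R)
      (\<lambda>hs. e (hs ! 0) \<otimes>\<^bsub>R\<^esub> form_lift R fs (iter_comult R H (length fs) (hs ! 1))) (comult H h)"
  proof (rule tensor_lift_cong[OF _ comult_closed[OF Cons.prems(2)]])
    fix hs assume "hs \<in> tuples H 2"
    then obtain x y where hs: "hs = [x, y]" "x \<in> carrier H" "y \<in> carrier H"
      by (auto simp: tuples_def numeral_2_eq_2 length_Suc_conv)
    then show "pure_pairing R [e, ?g] hs =
        e (hs ! 0) \<otimes>\<^bsub>R\<^esub> form_lift R fs (iter_comult R H (length fs) (hs ! 1))"
      using Cons form_lift_closed[OF _ iter_comult_closed, of fs y] by simp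
  qed
  also have "\<dots> = form_lift R (e # fs) (iter_comult R H (length (e # fs)) h)"
    using form_lift_iter_comult_Suc[of h e fs] Cons.prems by simp
  finally show ?case .
qed

end

section \<open>Homogeneous components\<close>

context graded_bialgebra
begin

lemma component_subset: "component H n \<subseteq> carrier H"
  using submoduleE(1)[OF component_submodule] .

lemma component_zero: "\<zero>\<^bsub>H\<^esub> \<in> component H n"
  using subgroup.one_closed[OF submodule.axioms(1)[OF component_submodule]] by simp

lemma component_add: "\<lbrakk>x \<in> component H n; y \<in> component H n\<rbrakk> \<Longrightarrow> x \<oplus>\<^bsub>H\<^esub> y \<in> component H n"
  using submoduleE(5)[OF component_submodule] .

lemma component_smult: "\<lbrakk>c \<in> carrier R; x \<in> component H n\<rbrakk> \<Longrightarrow> c \<odot>\<^bsub>H\<^esub> x \<in> component H n"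
  using submoduleE(4)[OF component_submodule] .

lemma homogeneous_decomp_sum:
  assumes "homogeneous_decomp H h g" "finite A" "{n. g n \<noteq> \<zero>\<^bsub>H\<^esub>} \<subseteq> A"
  shows "h = (\<Oplus>\<^bsub>H\<^esub>n\<in>A. g n)"
proof -
  have "(\<Oplus>\<^bsub>H\<^esub>n\<in>{n. g n \<noteq> \<zero>\<^bsub>H\<^esub>}. g n) = (\<Oplus>\<^bsub>H\<^esub>n\<in>A. g n)"
    using assms component_subset
    by (intro M.add.finprod_mono_neutral_cong_left) (auto simp: homogeneous_decomp_def)
  then show ?thesis
    using assms(1) by (simp add: homogeneous_decomp_def)
qed

lemma graded_proj_decomp:
  assumes "h \<in> carrier H"
  shows "homogeneous_decomp H h (\<lambda>n. graded_proj H n h)"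
  using theI'[OF direct_sum[OF assms]] by (simp add: graded_proj_def)

text \<open>By uniqueness, any finite sum of homogeneous terms indexed by their degrees is the
  decomposition of its value. Linearity of the projections then follows by scaling and adding
  decompositions.\<close>

lemma graded_proj_unique:
  assumes "\<And>n. g n \<in> component H n" "finite A" "\<And>n. n \<notin> A \<Longrightarrow> g n = \<zero>\<^bsub>H\<^esub>"
  shows "graded_proj H n (\<Oplus>\<^bsub>H\<^esub>m\<in>A. g m) = g n"
proof -
  let ?h = "\<Oplus>\<^bsub>H\<^esub>m\<in>A. g m"
  have g: "g \<in> A \<rightarrow> carrier H"
    using assms(1) component_subset by blast
  have "{n. g n \<noteq> \<zero>\<^bsub>H\<^esub>} \<subseteq> A"
    using assms(3) by blast
  then have "homogeneous_decomp H ?h g"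
    using assms(1,2) g finite_subset
    by (auto simp: homogeneous_decomp_def intro!: M.add.finprod_mono_neutral_cong_right)
  then have "g = (\<lambda>n. graded_proj H n ?h)"
    using direct_sum[of ?h] graded_proj_decomp[of ?h] g by (auto intro: M.finsum_closed)
  then show ?thesis by (metis (no_types))
qed

lemma graded_proj_component: "h \<in> carrier H \<Longrightarrow> graded_proj H n h \<in> component H n"
  using graded_proj_decomp by (simp add: homogeneous_decomp_def)

lemma graded_proj_closed: "h \<in> carrier H \<Longrightarrow> graded_proj H n h \<in> carrier H"
  using graded_proj_component component_subset by blast

lemma graded_proj_of_component:
  assumes "x \<in> component H n"
  shows "graded_proj H m x = (if m = n then x else \<zero>\<^bsub>H\<^esub>)"
  using graded_proj_unique[of "\<lambda>m. if m = n then x else \<zero>\<^bsub>H\<^esub>" "{n}" m] assms component_zero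
    component_subset[of n] by auto

text \<open>All ranges from some degree on are offered, so that the decompositions of two elements
  can be written over a common range.\<close>

lemma graded_proj_sum:
  assumes "h \<in> carrier H"
  obtains N where "\<And>n. n > N \<Longrightarrow> graded_proj H n h = \<zero>\<^bsub>H\<^esub>"
    and "\<And>L. L \<ge> N \<Longrightarrow> h = (\<Oplus>\<^bsub>H\<^esub>n\<in>{..L}. graded_proj H n h)"
proof -
  note decomp = graded_proj_decomp[OF assms]
  then obtain N where N: "\<forall>n\<in>{n. graded_proj H n h \<noteq> \<zero>\<^bsub>H\<^esub>}. n \<le> N"
    by (auto simp: homogeneous_decomp_def finite_nat_set_iff_bounded_le)
  show ?thesis
  proof
    show "graded_proj H n h = \<zero>\<^bsub>H\<^esub>" if "n > N" for n
      using N that by auto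
    show "h = (\<Oplus>\<^bsub>H\<^esub>n\<in>{..L}. graded_proj H n h)" if "L \<ge> N" for L
      using N that by (intro homogeneous_decomp_sum[OF decomp]) auto
  qed
qed

lemma graded_proj_hom: "graded_proj H n \<in> module_hom R H H"
proof (rule module_homI)
  fix x y c assume x: "x \<in> carrier H"
  show "graded_proj H n x \<in> carrier H" by (rule graded_proj_closed[OF x])
  obtain N where N: "\<And>n. n > N \<Longrightarrow> graded_proj H n x = \<zero>\<^bsub>H\<^esub>"
    "\<And>L. L \<ge> N \<Longrightarrow> x = (\<Oplus>\<^bsub>H\<^esub>n\<in>{..L}. graded_proj H n x)"
    using graded_proj_sum[OF x] by blast
  show "graded_proj H n (c \<odot>\<^bsub>H\<^esub> x) = c \<odot>\<^bsub>H\<^esub> graded_proj H n x" if "c \<in> carrier R"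
  proof -
    have "c \<odot>\<^bsub>H\<^esub> x = (\<Oplus>\<^bsub>H\<^esub>n\<in>{..N}. c \<odot>\<^bsub>H\<^esub> graded_proj H n x)"
      using finsum_smult_ldistr[of "{..N}" c "\<lambda>n. graded_proj H n x"] that N(2)[of N]
        graded_proj_closed[OF x] by auto
    then show ?thesis
      using graded_proj_unique[of "\<lambda>n. c \<odot>\<^bsub>H\<^esub> graded_proj H n x" "{..N}" n] that N(1)
        component_smult graded_proj_component[OF x] by simp
  qed
  assume y: "y \<in> carrier H"
  obtain L where L: "\<And>n. n > L \<Longrightarrow> graded_proj H n y = \<zero>\<^bsub>H\<^esub>"
    "\<And>K. K \<ge> L \<Longrightarrow> y = (\<Oplus>\<^bsub>H\<^esub>n\<in>{..K}. graded_proj H n y)"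
    using graded_proj_sum[OF y] by blast
  have "x \<oplus>\<^bsub>H\<^esub> y = (\<Oplus>\<^bsub>H\<^esub>n\<in>{..max N L}. graded_proj H n x \<oplus>\<^bsub>H\<^esub> graded_proj H n y)"
    using M.finsum_addf[of "\<lambda>n. graded_proj H n x" "{..max N L}" "\<lambda>n. graded_proj H n y"]
      N(2)[of "max N L"] L(2)[of "max N L"] graded_proj_closed[OF x] graded_proj_closed[OF y] by auto
  then show "graded_proj H n (x \<oplus>\<^bsub>H\<^esub> y) = graded_proj H n x \<oplus>\<^bsub>H\<^esub> graded_proj H n y"
    using graded_proj_unique[of "\<lambda>n. graded_proj H n x \<oplus>\<^bsub>H\<^esub> graded_proj H n y" "{..max N L}" n]
      N(1) L(1) component_add[OF graded_proj_component[OF x] graded_proj_component[OF y]] by simp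
qed

text \<open>The elements of D are the forms that satisfy this for some N. A bound, unlike a set of
  degrees, can be raised, so finitely many forms share one.\<close>

definition vanishes_above :: "nat \<Rightarrow> ('b \<Rightarrow> 'a) \<Rightarrow> bool" where
  "vanishes_above N f \<longleftrightarrow> (\<forall>n>N. \<forall>x\<in>component H n. f x = \<zero>\<^bsub>R\<^esub>)"

lemma vanishes_above_mono: "\<lbrakk>vanishes_above N f; N \<le> L\<rbrakk> \<Longrightarrow> vanishes_above L f"
  unfolding vanishes_above_def using le_less_trans by blast

text \<open>The range of summation depends on \<open>f\<close> alone: the parts of \<open>x\<close>
  in degrees above N are killed by \<open>f\<close>, however large their degrees are.\<close>

lemma form_eq_sum_proj:
  assumes "f \<in> forms" "vanishes_above N f" "x \<in> carrier H"
  shows "f x = (\<Oplus>\<^bsub>R\<^esub>n\<in>{..N}. f (graded_proj H n x))"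
proof -
  obtain L where L: "\<And>K. K \<ge> L \<Longrightarrow> x = (\<Oplus>\<^bsub>H\<^esub>n\<in>{..K}. graded_proj H n x)"
    using graded_proj_sum[OF assms(3)] by blast
  have "f x = f (\<Oplus>\<^bsub>H\<^esub>n\<in>{..max N L}. graded_proj H n x)"
    by (rule arg_cong[OF L]) simp
  also have "\<dots> = (\<Oplus>\<^bsub>R\<^esub>n\<in>{..max N L}. f (graded_proj H n x))"
    using module_hom_finsum[OF module_axioms module_R assms(1), of _ "{..max N L}"]
      graded_proj_closed[OF assms(3)] by simp
  also have "\<dots> = (\<Oplus>\<^bsub>R\<^esub>n\<in>{..N}. f (graded_proj H n x))"
    using assms graded_proj_component[OF assms(3)] graded_proj_closed[OF assms(3)]
      module_homD(1)[OF assms(1)]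
    by (intro R.add.finprod_mono_neutral_cong_right) (auto simp: vanishes_above_def not_le)
  finally show ?thesis .
qed

text \<open>Existence of coordinates gives the expansion, while their uniqueness makes them linear:
  scaling or adding two expansions gives an expansion of the scaled or added vector.\<close>

lemma component_dual_basis:
  assumes "finite_free R H (component H n)"
  obtains B d where "finite B" "B \<subseteq> component H n" "\<And>b. b \<in> B \<Longrightarrow> d b \<in> dual_component R H n"
    "\<And>x. x \<in> component H n \<Longrightarrow> (\<Oplus>\<^bsub>H\<^esub>b\<in>B. d b x \<odot>\<^bsub>H\<^esub> b) = x"
proof -
  from assms obtain B where B': "finite B \<and> B \<subseteq> component H n \<and>
      (\<forall>x\<in>component H n. \<exists>!c. c \<in> B \<rightarrow>\<^sub>E carrier R \<and> x = (\<Oplus>\<^bsub>H\<^esub>b\<in>B. c b \<odot>\<^bsub>H\<^esub> b))"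
    unfolding finite_free_def ..
  note B = B'[THEN conjunct1] B'[THEN conjunct2, THEN conjunct1]
    B'[THEN conjunct2, THEN conjunct2, rule_format]
  define coord where "coord x = (THE c. c \<in> B \<rightarrow>\<^sub>E carrier R \<and> x = (\<Oplus>\<^bsub>H\<^esub>b\<in>B. c b \<odot>\<^bsub>H\<^esub> b))" for x
  have coord': "coord x \<in> B \<rightarrow>\<^sub>E carrier R \<and> x = (\<Oplus>\<^bsub>H\<^esub>b\<in>B. coord x b \<odot>\<^bsub>H\<^esub> b)"
    if "x \<in> component H n" for x
    unfolding coord_def using theI'[OF B(3)[OF that]] .
  note coord = coord'[THEN conjunct2, symmetric]
  have coord_closed: "coord x b \<in> carrier R" if "x \<in> component H n" "b \<in> B" for x b
    using coord'[OF that(1), THEN conjunct1] that(2) by blast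
  have B_closed: "b \<in> carrier H" if "b \<in> B" for b
    using that B(2) component_subset by blast
  have coord_unique: "coord x b = c b"
    if "x \<in> component H n" "c \<in> B \<rightarrow> carrier R" "x = (\<Oplus>\<^bsub>H\<^esub>b\<in>B. c b \<odot>\<^bsub>H\<^esub> b)" "b \<in> B" for x c b
  proof -
    \<comment> \<open>Uniqueness holds among extensional coefficient families only, so
      \<open>c\<close> is first cut down to \<open>B\<close>.\<close>
    have "(\<Oplus>\<^bsub>H\<^esub>b\<in>B. restrict c B b \<odot>\<^bsub>H\<^esub> b) = (\<Oplus>\<^bsub>H\<^esub>b\<in>B. c b \<odot>\<^bsub>H\<^esub> b)"
      using that(2) B_closed by (intro M.finsum_cong') auto
    then have "restrict c B \<in> B \<rightarrow>\<^sub>E carrier R \<and> x = (\<Oplus>\<^bsub>H\<^esub>b\<in>B. restrict c B b \<odot>\<^bsub>H\<^esub> b)"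
      using that(2,3) restrict_PiE by simp
    then have "coord x = restrict c B"
      unfolding coord_def by (rule the1_equality[OF B(3)[OF that(1)]])
    then show ?thesis
      using that(4) by simp
  qed
  \<comment> \<open>Precomposing with the projection extends a coordinate of degree \<open>n\<close>
    by zero to all other degrees.\<close>
  define d where "d b = (\<lambda>x\<in>carrier H. coord (graded_proj H n x) b)" for b
  have "d b \<in> dual_component R H n" if b: "b \<in> B" for b
  proof -
    have "d b \<in> forms"
    proof (rule module_homI)
      fix x y c assume x: "x \<in> carrier H"
      then show "d b x \<in> carrier (ring_as_module R)"
        using coord_closed[OF graded_proj_component b] by (simp add: d_def)
      note px = graded_proj_component[OF x, of n]
      show "d b (c \<odot>\<^bsub>H\<^esub> x) = c \<odot>\<^bsub>ring_as_module R\<^esub> d b x" if c: "c \<in> carrier R"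
      proof -
        have "c \<odot>\<^bsub>H\<^esub> graded_proj H n x = c \<odot>\<^bsub>H\<^esub> (\<Oplus>\<^bsub>H\<^esub>b\<in>B. coord (graded_proj H n x) b \<odot>\<^bsub>H\<^esub> b)"
          using coord[OF px] by simp
        also have "\<dots> = (\<Oplus>\<^bsub>H\<^esub>b\<in>B. c \<odot>\<^bsub>H\<^esub> (coord (graded_proj H n x) b \<odot>\<^bsub>H\<^esub> b))"
          using B(1) B_closed c coord_closed[OF px] by (intro finsum_smult_ldistr) auto
        also have "\<dots> = (\<Oplus>\<^bsub>H\<^esub>b\<in>B. (c \<otimes>\<^bsub>R\<^esub> coord (graded_proj H n x) b) \<odot>\<^bsub>H\<^esub> b)"
          using B_closed c coord_closed[OF px] by (intro M.finsum_cong') (auto simp: smult_assoc1)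
        finally have "coord (c \<odot>\<^bsub>H\<^esub> graded_proj H n x) b = c \<otimes>\<^bsub>R\<^esub> coord (graded_proj H n x) b"
          using c b coord_closed[OF px] component_smult[OF c px]
          by (intro coord_unique[where c = "\<lambda>b. c \<otimes>\<^bsub>R\<^esub> coord (graded_proj H n x) b"]) auto
        then show ?thesis
          using x c by (simp add: d_def module_homD(3)[OF graded_proj_hom])
      qed
      assume y: "y \<in> carrier H"
      note py = graded_proj_component[OF y, of n]
      have "graded_proj H n x \<oplus>\<^bsub>H\<^esub> graded_proj H n y =
          (\<Oplus>\<^bsub>H\<^esub>b\<in>B. coord (graded_proj H n x) b \<odot>\<^bsub>H\<^esub> b) \<oplus>\<^bsub>H\<^esub> (\<Oplus>\<^bsub>H\<^esub>b\<in>B. coord (graded_proj H n y) b \<odot>\<^bsub>H\<^esub> b)"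
        using coord[OF px] coord[OF py] by simp
      also have "\<dots> = (\<Oplus>\<^bsub>H\<^esub>b\<in>B. coord (graded_proj H n x) b \<odot>\<^bsub>H\<^esub> b \<oplus>\<^bsub>H\<^esub> coord (graded_proj H n y) b \<odot>\<^bsub>H\<^esub> b)"
        using B_closed coord_closed[OF px] coord_closed[OF py]
        by (intro M.finsum_addf[symmetric]) auto
      also have "\<dots> = (\<Oplus>\<^bsub>H\<^esub>b\<in>B. (coord (graded_proj H n x) b \<oplus>\<^bsub>R\<^esub> coord (graded_proj H n y) b) \<odot>\<^bsub>H\<^esub> b)"
        using B_closed coord_closed[OF px] coord_closed[OF py]
        by (intro M.finsum_cong') (auto simp: smult_l_distr)
      finally have "coord (graded_proj H n x \<oplus>\<^bsub>H\<^esub> graded_proj H n y) b =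
          coord (graded_proj H n x) b \<oplus>\<^bsub>R\<^esub> coord (graded_proj H n y) b"
        using b coord_closed[OF px] coord_closed[OF py] component_add[OF px py]
        by (intro coord_unique[where
              c = "\<lambda>b. coord (graded_proj H n x) b \<oplus>\<^bsub>R\<^esub> coord (graded_proj H n y) b"]) auto
      then show "d b (x \<oplus>\<^bsub>H\<^esub> y) = d b x \<oplus>\<^bsub>ring_as_module R\<^esub> d b y"
        using x y by (simp add: d_def module_homD(2)[OF graded_proj_hom])
    qed
    moreover have "d b x = \<zero>\<^bsub>R\<^esub>" if "m \<noteq> n" "x \<in> component H m" for m x
    proof -
      \<comment> \<open>In other degrees the projection is zero, and by uniqueness the coordinates
        of zero vanish.\<close>
      have "\<zero>\<^bsub>H\<^esub> = (\<Oplus>\<^bsub>H\<^esub>b\<in>B. \<zero>\<^bsub>R\<^esub> \<odot>\<^bsub>H\<^esub> b)"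
        using B_closed by (intro M.add.finprod_one_eqI[symmetric]) auto
      then have "coord \<zero>\<^bsub>H\<^esub> b = \<zero>\<^bsub>R\<^esub>"
        using component_zero b by (intro coord_unique[where c = "\<lambda>_. \<zero>\<^bsub>R\<^esub>"]) auto
      then show ?thesis
        using that component_subset graded_proj_of_component[OF that(2), of n] by (auto simp: d_def)
    qed
    ultimately show ?thesis
      by (auto simp: dual_component_def linear_forms_def d_def)
  qed
  moreover have "(\<Oplus>\<^bsub>H\<^esub>b\<in>B. d b x \<odot>\<^bsub>H\<^esub> b) = x" if x: "x \<in> component H n" for x
  proof -
    have "(\<Oplus>\<^bsub>H\<^esub>b\<in>B. d b x \<odot>\<^bsub>H\<^esub> b) = (\<Oplus>\<^bsub>H\<^esub>b\<in>B. coord x b \<odot>\<^bsub>H\<^esub> b)"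
      using x component_subset B_closed coord_closed[OF x]
      by (intro M.finsum_cong') (auto simp: d_def graded_proj_of_component)
    then show ?thesis
      using coord[OF x] by simp
  qed
  ultimately show ?thesis
    using B(1,2) that by blast
qed

end

lemma finsum_hom:
  assumes "module R M" "module R N" "\<And>j. j \<in> J \<Longrightarrow> \<phi> j \<in> module_hom R M N"
  shows "(\<lambda>x. \<Oplus>\<^bsub>N\<^esub>j\<in>J. \<phi> j x) \<in> module_hom R M N"
proof (cases "finite J")
  interpret M: module R M by fact
  interpret N: module R N by fact
  case True
  have closed: "(\<lambda>j. \<phi> j x) \<in> J \<rightarrow> carrier N" if "x \<in> carrier M" for x
    using module_homD(1)[OF assms(3) that] by blast
  show ?thesis
  proof (rule module_homI)
    fix x y c assume x: "x \<in> carrier M"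
    show "(\<Oplus>\<^bsub>N\<^esub>j\<in>J. \<phi> j x) \<in> carrier N"
      using closed[OF x] by (rule N.finsum_closed)
    show "(\<Oplus>\<^bsub>N\<^esub>j\<in>J. \<phi> j (c \<odot>\<^bsub>M\<^esub> x)) = c \<odot>\<^bsub>N\<^esub> (\<Oplus>\<^bsub>N\<^esub>j\<in>J. \<phi> j x)" if "c \<in> carrier R"
      unfolding N.finsum_smult_ldistr[OF True that closed[OF x]]
      using module_homD(3)[OF assms(3) that x] funcset_mem[OF closed[OF x]] that
      by (intro N.finsum_cong') auto
    assume y: "y \<in> carrier M"
    show "(\<Oplus>\<^bsub>N\<^esub>j\<in>J. \<phi> j (x \<oplus>\<^bsub>M\<^esub> y)) = (\<Oplus>\<^bsub>N\<^esub>j\<in>J. \<phi> j x) \<oplus>\<^bsub>N\<^esub> (\<Oplus>\<^bsub>N\<^esub>j\<in>J. \<phi> j y)"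
      unfolding N.finsum_addf[OF closed[OF x] closed[OF y], symmetric]
      using module_homD(2)[OF assms(3) x y] funcset_mem[OF closed[OF x]] funcset_mem[OF closed[OF y]]
      by (intro N.finsum_cong') auto
  qed
next
  interpret N: module R N by fact
  case False
  then show ?thesis
    by (auto intro: module_homI)
qed

section \<open>The graded dual\<close>

lemma graded_dual_simps:
  "carrier (graded_dual R H) = carrier (graded_dual_algebra R H)"
  "monoid.mult (graded_dual R H) = monoid.mult (graded_dual_algebra R H)"
  "one (graded_dual R H) = one (graded_dual_algebra R H)"
  "zero (graded_dual R H) = (\<lambda>h\<in>carrier H. \<zero>\<^bsub>R\<^esub>)"
  "add (graded_dual R H) = (\<lambda>f g. \<lambda>h\<in>carrier H. f h \<oplus>\<^bsub>R\<^esub> g h)"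
  "smult (graded_dual R H) = (\<lambda>c f. \<lambda>h\<in>carrier H. c \<otimes>\<^bsub>R\<^esub> f h)"
  "counit (graded_dual R H) = (\<lambda>f. f \<one>\<^bsub>H\<^esub>)"
  "component (graded_dual R H) = dual_component R H"
  by (simp_all add: graded_dual_def module.extend_def graded_bialgebra.fields_def
      graded_dual_algebra_def)

lemma graded_dual_tensor_power:
  "tensor_power R (graded_dual_algebra R H) k = tensor_power R (graded_dual R H) k"
  by (rule tensor_power_cong)
    (simp_all add: graded_dual_def module.extend_def graded_bialgebra.fields_def)

text \<open>These functionals on D are the images of points of H in the bidual; products of them are
  the test functionals for tensors over D.\<close>

abbreviation evals :: "'b list \<Rightarrow> (('b \<Rightarrow> 'a) \<Rightarrow> 'a) list" where
  "evals hs \<equiv> map (\<lambda>h f. f h) hs"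

lemma pure_pairing_evals:
  "length fs = length hs \<Longrightarrow> pure_pairing R (evals hs) fs = pure_pairing R fs hs"
  by (induction fs hs rule: list_induct2) simp_all

context graded_bialgebra
begin

lemma proj_dual_component:
  assumes "f \<in> forms"
  shows "(\<lambda>x\<in>carrier H. f (graded_proj H n x)) \<in> dual_component R H n"
proof -
  have "(\<lambda>x. f (graded_proj H n x)) \<in> forms"
    by (rule module_hom_compose[OF graded_proj_hom assms])
  then have "(\<lambda>x\<in>carrier H. f (graded_proj H n x)) \<in> linear_forms R H"
    by (auto simp: linear_forms_def module_hom_def)
  moreover have "(\<lambda>x\<in>carrier H. f (graded_proj H n x)) x = \<zero>\<^bsub>R\<^esub>"
    if "m \<noteq> n" "x \<in> component H m" for m x
    using that component_subset[of m] module_hom_zero[OF module_axioms module_R assms]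
    by (auto simp: graded_proj_of_component[OF that(2)])
  ultimately show ?thesis
    by (simp add: dual_component_def)
qed

text \<open>A finite sum of homogeneous forms has a largest degree. Conversely, a form with a degree
  bound is the sum of its composites with the projections up to that bound.\<close>

lemma carrier_graded_dual:
  "carrier (graded_dual R H) = {f \<in> linear_forms R H. \<exists>N. vanishes_above N f}"
proof (intro equalityI subsetI)
  fix f assume "f \<in> carrier (graded_dual R H)"
  then obtain I g where I: "finite I" "\<And>n. n \<in> I \<Longrightarrow> g n \<in> dual_component R H n"
    and f: "f = (\<lambda>h\<in>carrier H. \<Oplus>\<^bsub>R\<^esub>n\<in>I. g n h)"
    by (auto simp: graded_dual_simps graded_dual_algebra_def)
  have "(\<lambda>h. \<Oplus>\<^bsub>R\<^esub>n\<in>I. g n h) \<in> forms"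
    using finsum_hom[OF module_axioms module_R, of I g] I(2)
    by (auto simp: dual_component_def linear_forms_def)
  then have "f \<in> linear_forms R H"
    by (auto simp: f linear_forms_def module_hom_def)
  moreover obtain N where N: "\<forall>n\<in>I. n \<le> N"
    using I(1) by (auto simp: finite_nat_set_iff_bounded_le)
  have "f x = \<zero>\<^bsub>R\<^esub>" if "n > N" "x \<in> component H n" for n x
  proof -
    have "(\<Oplus>\<^bsub>R\<^esub>m\<in>I. g m x) = \<zero>\<^bsub>R\<^esub>"
      using I(2) that N by (intro R.add.finprod_one_eqI) (force simp: dual_component_def)
    then show ?thesis
      using that component_subset by (auto simp: f)
  qed
  then have "vanishes_above N f"
    by (simp add: vanishes_above_def)
  ultimately show "f \<in> {f \<in> linear_forms R H. \<exists>N. vanishes_above N f}" by blast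
next
  fix f assume "f \<in> {f \<in> linear_forms R H. \<exists>N. vanishes_above N f}"
  then obtain N where f: "f \<in> forms" "f \<in> extensional (carrier H)" "vanishes_above N f"
    by (auto simp: linear_forms_def)
  define g where "g n = (\<lambda>x\<in>carrier H. f (graded_proj H n x))" for n
  have "g n \<in> dual_component R H n" for n
    unfolding g_def by (rule proj_dual_component[OF f(1)])
  moreover have "f = (\<lambda>h\<in>carrier H. \<Oplus>\<^bsub>R\<^esub>n\<in>{..N}. g n h)"
  proof (rule extensionalityI[OF f(2)])
    fix x assume "x \<in> carrier H"
    then show "f x = (\<lambda>h\<in>carrier H. \<Oplus>\<^bsub>R\<^esub>n\<in>{..N}. g n h) x"
      using form_eq_sum_proj[OF f(1,3)] by (simp add: g_def)
  qed simp
  ultimately show "f \<in> carrier (graded_dual R H)"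
    unfolding graded_dual_simps graded_dual_algebra_def by (auto intro!: exI[of _ "{..N}"])
qed

lemma graded_dual_form: "f \<in> carrier (graded_dual R H) \<Longrightarrow> f \<in> forms"
  by (simp add: carrier_graded_dual linear_forms_def)

lemma graded_dual_extensional: "f \<in> carrier (graded_dual R H) \<Longrightarrow> f \<in> extensional (carrier H)"
  by (simp add: carrier_graded_dual linear_forms_def)

lemma graded_dual_eqI:
  "\<lbrakk>f \<in> carrier (graded_dual R H); g \<in> carrier (graded_dual R H);
    \<And>x. x \<in> carrier H \<Longrightarrow> f x = g x\<rbrakk> \<Longrightarrow> f = g"
  using extensionalityI[OF graded_dual_extensional graded_dual_extensional] by blast

lemma graded_dualI:
  assumes "f \<in> forms" "vanishes_above N f"
  shows "restrict f (carrier H) \<in> carrier (graded_dual R H)"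
proof -
  have "vanishes_above N (restrict f (carrier H))"
    unfolding vanishes_above_def
    using assms(2) component_subset by (metis restrict_apply' subsetD vanishes_above_def)
  then show ?thesis
    using assms(1) by (auto simp: carrier_graded_dual linear_forms_def module_hom_def)
qed

lemma dual_component_subset: "dual_component R H n \<subseteq> carrier (graded_dual R H)"
  by (auto simp: dual_component_def carrier_graded_dual vanishes_above_def intro!: exI[of _ n])

section \<open>The module structure of the graded dual and its projections\<close>

lemma graded_dual_closed:
  assumes "f \<in> carrier (graded_dual R H)"
  shows "c \<in> carrier R \<Longrightarrow> c \<odot>\<^bsub>graded_dual R H\<^esub> f \<in> carrier (graded_dual R H)"
    and "g \<in> carrier (graded_dual R H) \<Longrightarrow> f \<oplus>\<^bsub>graded_dual R H\<^esub> g \<in> carrier (graded_dual R H)"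
proof -
  note f = graded_dual_form[OF assms]
  obtain N where N: "vanishes_above N f"
    using assms by (auto simp: carrier_graded_dual)
  show "c \<odot>\<^bsub>graded_dual R H\<^esub> f \<in> carrier (graded_dual R H)" if c: "c \<in> carrier R"
    unfolding graded_dual_simps(6)
    using module_hom_compose[OF f scale_hom[OF c]] N c
    by (intro graded_dualI[of _ N]) (auto simp: vanishes_above_def)
  show "f \<oplus>\<^bsub>graded_dual R H\<^esub> g \<in> carrier (graded_dual R H)" if g: "g \<in> carrier (graded_dual R H)"
  proof -
    obtain L where L: "vanishes_above L g"
      using g by (auto simp: carrier_graded_dual)
    have "vanishes_above (max N L) (\<lambda>x. f x \<oplus>\<^bsub>R\<^esub> g x)"
      using N L by (auto simp: vanishes_above_def)
    moreover have "(\<lambda>x. f x \<oplus>\<^bsub>R\<^esub> g x) \<in> forms"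
      using module_homD[OF f] module_homD[OF graded_dual_form[OF g]]
      by (intro module_homI) (auto simp: R.a_ac R.r_distr)
    ultimately show ?thesis
      unfolding graded_dual_simps(5) by (rule graded_dualI[rotated])
  qed
qed

lemma module_graded_dual: "module R (graded_dual R H)"
proof (intro moduleI abelian_groupI)
  let ?D = "graded_dual R H"
  show "cring R" by (rule R.is_cring)
  have "restrict (\<lambda>_. \<zero>\<^bsub>R\<^esub>) (carrier H) \<in> carrier ?D"
    by (rule graded_dualI) (auto intro: module_homI simp: vanishes_above_def)
  then show zero: "\<zero>\<^bsub>?D\<^esub> \<in> carrier ?D"
    by (simp add: graded_dual_simps)
  have val: "f x \<in> carrier R" if "f \<in> carrier ?D" "x \<in> carrier H" for f x
    using module_homD(1)[OF graded_dual_form[OF that(1)] that(2)] by simp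
  note closed = graded_dual_closed
  note ops = graded_dual_simps(4-6)
  fix f g k assume f: "f \<in> carrier ?D" and g: "g \<in> carrier ?D" and k: "k \<in> carrier ?D"
  show "f \<oplus>\<^bsub>?D\<^esub> g \<in> carrier ?D" by (rule closed(2)[OF f g])
  show "f \<oplus>\<^bsub>?D\<^esub> g \<oplus>\<^bsub>?D\<^esub> k = f \<oplus>\<^bsub>?D\<^esub> (g \<oplus>\<^bsub>?D\<^esub> k)"
    by (rule graded_dual_eqI) (simp_all add: f g k closed, simp add: ops val f g k R.a_assoc)
  show "f \<oplus>\<^bsub>?D\<^esub> g = g \<oplus>\<^bsub>?D\<^esub> f"
    by (rule graded_dual_eqI) (simp_all add: f g closed, simp add: ops val f g R.a_comm)
  show "\<zero>\<^bsub>?D\<^esub> \<oplus>\<^bsub>?D\<^esub> f = f"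
    by (rule graded_dual_eqI) (simp_all add: f zero closed, simp add: ops val f)
  have "(\<ominus>\<^bsub>R\<^esub> \<one>\<^bsub>R\<^esub>) \<odot>\<^bsub>?D\<^esub> f \<oplus>\<^bsub>?D\<^esub> f = \<zero>\<^bsub>?D\<^esub>"
    by (rule graded_dual_eqI)
      (simp_all add: f zero closed, simp add: ops val f R.l_minus R.l_neg)
  then show "\<exists>g\<in>carrier ?D. g \<oplus>\<^bsub>?D\<^esub> f = \<zero>\<^bsub>?D\<^esub>"
    using closed(1)[OF f] by blast
  show "\<one>\<^bsub>R\<^esub> \<odot>\<^bsub>?D\<^esub> f = f"
    by (rule graded_dual_eqI) (simp_all add: f closed, simp add: ops val f)
  fix a b assume a: "a \<in> carrier R" and b: "b \<in> carrier R"
  show "a \<odot>\<^bsub>?D\<^esub> f \<in> carrier ?D" by (rule closed(1)[OF f a])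
  show "a \<odot>\<^bsub>?D\<^esub> (f \<oplus>\<^bsub>?D\<^esub> g) = a \<odot>\<^bsub>?D\<^esub> f \<oplus>\<^bsub>?D\<^esub> a \<odot>\<^bsub>?D\<^esub> g"
    by (rule graded_dual_eqI) (simp_all add: a f g closed, simp add: ops val a f g R.r_distr)
  show "(a \<oplus>\<^bsub>R\<^esub> b) \<odot>\<^bsub>?D\<^esub> f = a \<odot>\<^bsub>?D\<^esub> f \<oplus>\<^bsub>?D\<^esub> b \<odot>\<^bsub>?D\<^esub> f"
    by (rule graded_dual_eqI) (simp_all add: a b f closed, simp add: ops val a b f R.l_distr)
  show "(a \<otimes>\<^bsub>R\<^esub> b) \<odot>\<^bsub>?D\<^esub> f = a \<odot>\<^bsub>?D\<^esub> (b \<odot>\<^bsub>?D\<^esub> f)"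
    by (rule graded_dual_eqI) (simp_all add: a b f closed, simp add: ops val a b f R.m_assoc)
qed

interpretation dual: module R "graded_dual R H"
  by (rule module_graded_dual)

lemma eval_hom: "x \<in> carrier H \<Longrightarrow> (\<lambda>f. f x) \<in> dual.forms"
  using module_homD(1)[OF graded_dual_form] by (intro module_homI) (auto simp: graded_dual_simps(5,6))

lemma evals_forms: "hs \<in> tuples H k \<Longrightarrow> set (evals hs) \<subseteq> dual.forms"
  using eval_hom by (auto simp: tuples_def)

lemma finsum_graded_dual:
  "\<lbrakk>g \<in> A \<rightarrow> carrier (graded_dual R H); x \<in> carrier H\<rbrakk> \<Longrightarrow>
    (\<Oplus>\<^bsub>graded_dual R H\<^esub>a\<in>A. g a) x = (\<Oplus>\<^bsub>R\<^esub>a\<in>A. g a x)"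
  using module_hom_finsum[OF module_graded_dual module_R eval_hom] by simp

text \<open>This is the self-adjointness of the projections. Since \<open>graded_proj\<close> is a
  definite description, the composites of \<open>f\<close> with the projections must be shown to be
  a decomposition in D and the only one.\<close>

lemma graded_proj_dual:
  assumes "f \<in> carrier (graded_dual R H)"
  shows "graded_proj (graded_dual R H) n f = (\<lambda>x\<in>carrier H. f (graded_proj H n x))"
proof -
  define g where "g n = (\<lambda>x\<in>carrier H. f (graded_proj H n x))" for n
  note f = graded_dual_form[OF assms]
  obtain N where N: "vanishes_above N f"
    using assms by (auto simp: carrier_graded_dual)
  have g: "g n \<in> dual_component R H n" for n
    unfolding g_def by (rule proj_dual_component[OF f])
  then have g_closed: "g n \<in> carrier (graded_dual R H)" for n
    using dual_component_subset by blast
  have supp: "{n. g n \<noteq> \<zero>\<^bsub>graded_dual R H\<^esub>} \<subseteq> {..N}"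
  proof (rule subsetI, rule ccontr)
    fix n assume n: "n \<in> {n. g n \<noteq> \<zero>\<^bsub>graded_dual R H\<^esub>}" "n \<notin> {..N}"
    then have "g n = \<zero>\<^bsub>graded_dual R H\<^esub>"
      using N graded_proj_component
      by (auto simp: g_def graded_dual_simps(4) vanishes_above_def not_le intro!: restrict_ext)
    then show False
      using n(1) by simp
  qed
  have "f = (\<Oplus>\<^bsub>graded_dual R H\<^esub>n\<in>{n. g n \<noteq> \<zero>\<^bsub>graded_dual R H\<^esub>}. g n)"
  proof -
    have "f = (\<Oplus>\<^bsub>graded_dual R H\<^esub>n\<in>{..N}. g n)"
      using g_closed assms form_eq_sum_proj[OF f N]
      by (intro graded_dual_eqI) (auto simp: finsum_graded_dual g_def)
    also have "\<dots> = (\<Oplus>\<^bsub>graded_dual R H\<^esub>n\<in>{n. g n \<noteq> \<zero>\<^bsub>graded_dual R H\<^esub>}. g n)"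
      using supp g_closed by (intro dual.M.add.finprod_mono_neutral_cong_right) auto
    finally show ?thesis .
  qed
  then have decomp: "homogeneous_decomp (graded_dual R H) f g"
    using g finite_subset[OF supp] by (simp add: homogeneous_decomp_def graded_dual_simps(8))
  \<comment> \<open>A competing term \<open>g' n\<close> sees only the degree \<open>n\<close> part
    of its argument, and on that part all other terms vanish; hence it agrees there with
    \<open>f\<close>.\<close>
  have "g' = g" if "homogeneous_decomp (graded_dual R H) f g'" for g'
  proof
    fix n
    let ?A = "{n. g' n \<noteq> \<zero>\<^bsub>graded_dual R H\<^esub>}"
    have g': "\<And>n. g' n \<in> dual_component R H n" "finite ?A" "f = (\<Oplus>\<^bsub>graded_dual R H\<^esub>n\<in>?A. g' n)"
      using that by (auto simp: homogeneous_decomp_def graded_dual_simps(8))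
    have g'_closed: "g' n \<in> carrier (graded_dual R H)" for n
      using g'(1) dual_component_subset by blast
    have val: "g' m x \<in> carrier R" if "x \<in> carrier H" for m x
      using module_homD(1)[OF graded_dual_form[OF g'_closed] that] by simp
    have "vanishes_above n (g' n)"
      using g'(1)[of n] by (auto simp: dual_component_def vanishes_above_def)
    note sum = form_eq_sum_proj[OF graded_dual_form[OF g'_closed] this]
    have off: "g' m y = \<zero>\<^bsub>R\<^esub>" if "m \<noteq> n" "y \<in> component H n" for m n y
      using g'(1)[of m] that by (auto simp: dual_component_def)
    show "g' n = g n"
    proof (rule graded_dual_eqI[OF g'_closed g_closed])
      fix x assume x: "x \<in> carrier H"
      let ?y = "graded_proj H n x"
      note y = graded_proj_component[OF x, of n] graded_proj_closed[OF x, of n]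
      have "g' n x = (\<Oplus>\<^bsub>R\<^esub>m\<in>{..n}. g' n (graded_proj H m x))"
        by (rule sum[OF x])
      also have "\<dots> = (\<Oplus>\<^bsub>R\<^esub>m\<in>{n}. g' n (graded_proj H m x))"
        using val graded_proj_closed[OF x] off[OF _ graded_proj_component[OF x]]
        by (intro R.add.finprod_mono_neutral_cong_right) auto
      \<comment> \<open>The degree \<open>n\<close> may lie outside the support of
        \<open>g'\<close>, so it is inserted first and dropped again afterwards, its term then being
        zero.\<close>
      also have "\<dots> = (\<Oplus>\<^bsub>R\<^esub>m\<in>insert n ?A. g' m ?y)"
        using val y(2) off[OF _ y(1)] g'(2)
        by (intro R.add.finprod_mono_neutral_cong_left) auto
      also have "\<dots> = (\<Oplus>\<^bsub>R\<^esub>m\<in>?A. g' m ?y)"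
        using val y g'(2)
        by (intro R.add.finprod_mono_neutral_cong_right) (auto simp: graded_dual_simps(4))
      also have "\<dots> = f ?y"
        using g'_closed y(2) by (subst g'(3), subst finsum_graded_dual) auto
      finally show "g' n x = g n x"
        using x by (simp add: g_def)
    qed
  qed
  then have "(THE g. homogeneous_decomp (graded_dual R H) f g) = g"
    using decomp by (intro the_equality)
  then show ?thesis
    by (simp add: graded_proj_def g_def)
qed

lemma graded_proj_dual_hom:
  "graded_proj (graded_dual R H) n \<in> module_hom R (graded_dual R H) (graded_dual R H)"
proof (rule module_homI)
  fix f g c assume f: "f \<in> carrier (graded_dual R H)"
  obtain N where "vanishes_above N f"
    using f by (auto simp: carrier_graded_dual)
  then have "vanishes_above (max N n) (\<lambda>x. f (graded_proj H n x))"
    using module_hom_zero[OF module_axioms module_R graded_dual_form[OF f]]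
    by (auto simp: vanishes_above_def graded_proj_of_component)
  then show "graded_proj (graded_dual R H) n f \<in> carrier (graded_dual R H)"
    unfolding graded_proj_dual[OF f]
    by (rule graded_dualI[OF module_hom_compose[OF graded_proj_hom graded_dual_form[OF f]]])
  show "graded_proj (graded_dual R H) n (c \<odot>\<^bsub>graded_dual R H\<^esub> f) =
      c \<odot>\<^bsub>graded_dual R H\<^esub> graded_proj (graded_dual R H) n f" if c: "c \<in> carrier R"
    unfolding graded_proj_dual[OF f] graded_proj_dual[OF dual.smult_closed[OF c f]]
    using graded_proj_closed by (auto simp: graded_dual_simps(6))
  assume g: "g \<in> carrier (graded_dual R H)"
  show "graded_proj (graded_dual R H) n (f \<oplus>\<^bsub>graded_dual R H\<^esub> g) =
      graded_proj (graded_dual R H) n f \<oplus>\<^bsub>graded_dual R H\<^esub> graded_proj (graded_dual R H) n g"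
    unfolding graded_proj_dual[OF f] graded_proj_dual[OF g]
      graded_proj_dual[OF graded_dual_closed(2)[OF f g]]
    using graded_proj_closed by (auto simp: graded_dual_simps(5))
qed

end

section \<open>Dual frames and the comultiplication of the graded dual\<close>

locale graded_bialgebra_finite = graded_bialgebra R H
  for R :: "('a, 'r) ring_scheme" (structure)
    and H :: "('a, 'b, 'h) graded_bialgebra_scheme" (structure) +
  assumes component_finite_free: "finite_free R H (component H n)"
begin

interpretation dual: module R "graded_dual R H"
  by (rule module_graded_dual)

text \<open>A finite resolution of the identity: \<open>x\<close> agrees with the sum of the vectors
  \<open>e j\<close> weighted by \<open>d j x\<close> as far as forms vanishing above N can see. The
  condition ranges over all forms, not only over D, because it is applied to maps such as
  \<open>y \<mapsto> f (x \<otimes> y)\<close>, which are not cut off outside the carrier.\<close>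

definition dual_frame :: "nat \<Rightarrow> 'i set \<Rightarrow> ('i \<Rightarrow> 'b) \<Rightarrow> ('i \<Rightarrow> 'b \<Rightarrow> 'a) \<Rightarrow> bool" where
  "dual_frame N J e d \<longleftrightarrow> finite J \<and> e \<in> J \<rightarrow> carrier H \<and> d \<in> J \<rightarrow> carrier (graded_dual R H) \<and>
     (\<forall>g\<in>forms. vanishes_above N g \<longrightarrow> (\<forall>x\<in>carrier H. g x = (\<Oplus>\<^bsub>R\<^esub>j\<in>J. d j x \<otimes>\<^bsub>R\<^esub> g (e j))))"

lemma dual_frame_expand:
  "\<lbrakk>dual_frame N J e d; g \<in> forms; vanishes_above N g; x \<in> carrier H\<rbrakk> \<Longrightarrow>
    g x = (\<Oplus>\<^bsub>R\<^esub>j\<in>J. d j x \<otimes>\<^bsub>R\<^esub> g (e j))"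
  unfolding dual_frame_def by blast

lemma dual_frame_exists: "\<exists>(J :: (nat \<times> 'b) set) e d. dual_frame N J e d"
proof -
  \<comment> \<open>Bundling the data of one degree lets a single choice produce dual bases in all
    degrees.\<close>
  define P where "P n B d \<longleftrightarrow> finite B \<and> B \<subseteq> component H n \<and> (\<forall>b\<in>B. d b \<in> dual_component R H n) \<and>
      (\<forall>x\<in>component H n. (\<Oplus>\<^bsub>H\<^esub>b\<in>B. d b x \<odot>\<^bsub>H\<^esub> b) = x)" for n B d
  have "\<exists>B d. P n B d" for n
  proof -
    obtain B d where "finite B" "B \<subseteq> component H n" "\<And>b. b \<in> B \<Longrightarrow> d b \<in> dual_component R H n"
      "\<And>x. x \<in> component H n \<Longrightarrow> (\<Oplus>\<^bsub>H\<^esub>b\<in>B. d b x \<odot>\<^bsub>H\<^esub> b) = x"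
      by (rule component_dual_basis[OF component_finite_free[of n]]) (rule that)
    then have "P n B d"
      by (simp add: P_def)
    then show ?thesis by blast
  qed
  then obtain B d where "\<And>n. P n (B n) (d n)"
    by metis
  then have B: "\<And>n. finite (B n)" "\<And>n. B n \<subseteq> component H n"
    and d: "\<And>n b. b \<in> B n \<Longrightarrow> d n b \<in> dual_component R H n"
    and sum: "\<And>n x. x \<in> component H n \<Longrightarrow> (\<Oplus>\<^bsub>H\<^esub>b\<in>B n. d n b x \<odot>\<^bsub>H\<^esub> b) = x"
    by (simp_all add: P_def)
  \<comment> \<open>Pairing each basis vector with its degree makes the union of the bases disjoint
    by construction.\<close>
  let ?J = "Sigma {..N} B"
  have B_closed: "b \<in> carrier H" if "b \<in> B n" for b n
    using that B(2) component_subset by blast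
  have d_closed: "d n b \<in> carrier (graded_dual R H)" if "b \<in> B n" for n b
    using d[OF that] dual_component_subset by blast
  have val: "d n b x \<in> carrier R" if "b \<in> B n" "x \<in> carrier H" for n b x
    using module_homD(1)[OF graded_dual_form[OF d_closed[OF that(1)]] that(2)] by simp
  \<comment> \<open>The dual basis expands \<open>graded_proj H n x\<close>, but a frame has to use
    the coefficients at \<open>x\<close> itself; the two agree because \<open>d n b\<close> lives in
    degree \<open>n\<close>.\<close>
  have d_proj: "d n b x = d n b (graded_proj H n x)" if b: "b \<in> B n" and x: "x \<in> carrier H" for n b x
  proof -
    have "d n b x = graded_proj (graded_dual R H) n (d n b) x"
    proof -
      have "vanishes_above n (d n b)"
        using d[OF b] by (auto simp: dual_component_def vanishes_above_def)
      then have "d n b x = (\<Oplus>\<^bsub>R\<^esub>m\<in>{..n}. d n b (graded_proj H m x))"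
        using form_eq_sum_proj[OF graded_dual_form[OF d_closed[OF b]]] x by blast
      also have "\<dots> = (\<Oplus>\<^bsub>R\<^esub>m\<in>{n}. d n b (graded_proj H m x))"
        using val[OF b] graded_proj_closed[OF x] graded_proj_component[OF x] d[OF b]
        by (intro R.add.finprod_mono_neutral_cong_right) (auto simp: dual_component_def)
      finally show ?thesis
        using x val[OF b] graded_proj_closed[OF x] by (simp add: graded_proj_dual[OF d_closed[OF b]])
    qed
    then show ?thesis
      using x by (simp add: graded_proj_dual[OF d_closed[OF b]])
  qed
  have "g x = (\<Oplus>\<^bsub>R\<^esub>j\<in>?J. d (fst j) (snd j) x \<otimes>\<^bsub>R\<^esub> g (snd j))"
    if g: "g \<in> forms" and N: "vanishes_above N g" and x: "x \<in> carrier H" for g x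
  proof -
    note g_val = module_homD(1)[OF g, simplified]
    have "g (graded_proj H n x) = (\<Oplus>\<^bsub>R\<^esub>b\<in>B n. d n b x \<otimes>\<^bsub>R\<^esub> g b)" for n
    proof -
      have "g (graded_proj H n x) = g (\<Oplus>\<^bsub>H\<^esub>b\<in>B n. d n b (graded_proj H n x) \<odot>\<^bsub>H\<^esub> b)"
        using sum[OF graded_proj_component[OF x]] by simp
      also have "\<dots> = (\<Oplus>\<^bsub>R\<^esub>b\<in>B n. g (d n b (graded_proj H n x) \<odot>\<^bsub>H\<^esub> b))"
        using module_hom_finsum[OF module_axioms module_R g,
            of "\<lambda>b. d n b (graded_proj H n x) \<odot>\<^bsub>H\<^esub> b" "B n"]
          val graded_proj_closed[OF x] B_closed by auto
      also have "\<dots> = (\<Oplus>\<^bsub>R\<^esub>b\<in>B n. d n b x \<otimes>\<^bsub>R\<^esub> g b)"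
        using val graded_proj_closed[OF x] B_closed g_val x
        by (intro R.finsum_cong') (auto simp: module_homD(3)[OF g] d_proj[symmetric])
      finally show ?thesis .
    qed
    then have "g x = (\<Oplus>\<^bsub>R\<^esub>n\<in>{..N}. \<Oplus>\<^bsub>R\<^esub>b\<in>B n. d n b x \<otimes>\<^bsub>R\<^esub> g b)"
      using form_eq_sum_proj[OF g N x] by simp
    also have "\<dots> = (\<Oplus>\<^bsub>R\<^esub>j\<in>?J. d (fst j) (snd j) x \<otimes>\<^bsub>R\<^esub> g (snd j))"
      using B(1) val x B_closed g_val by (subst R.finsum_Sigma) auto
    finally show ?thesis .
  qed
  then have "dual_frame N ?J snd (\<lambda>j. d (fst j) (snd j))"
    unfolding dual_frame_def using B(1) B_closed d_closed by auto
  then show ?thesis by blast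
qed

lemma form_lift_evals_pair:
  assumes "x \<in> carrier H" "y \<in> carrier H" "g \<in> carrier (graded_dual R H)" "g' \<in> carrier (graded_dual R H)"
  shows "form_lift R (evals [x, y]) (pure_tensor R (graded_dual R H) [g, g']) = g x \<otimes>\<^bsub>R\<^esub> g' y"
  using dual.form_lift_pure[OF evals_forms[of "[x, y]" 2], of "[g, g']"] assms
    module_homD(1)[OF graded_dual_form]
  by (simp add: numeral_2_eq_2)

text \<open>Fixing one factor of a product turns \<open>f\<close> into a form in the other factor,
  to which a frame can be applied.\<close>

lemma mult_form_left:
  assumes "f \<in> forms" "x \<in> carrier H"
  shows "(\<lambda>y. f (x \<otimes>\<^bsub>H\<^esub> y)) \<in> forms"
  using assms
  by (intro module_hom_compose[OF module_homI[of H "\<lambda>y. x \<otimes>\<^bsub>H\<^esub> y" H R] assms(1)])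
    (auto simp: r_distr smult_mult_right)

lemma mult_form_right:
  assumes "f \<in> forms" "y \<in> carrier H"
  shows "(\<lambda>x. f (x \<otimes>\<^bsub>H\<^esub> y)) \<in> forms"
  using assms
  by (intro module_hom_compose[OF module_homI[of H "\<lambda>x. x \<otimes>\<^bsub>H\<^esub> y" H R] assms(1)])
    (auto simp: l_distr smult_mult_left)

end

lemma (in module) scale_fixed_hom:
  assumes "module R N" "\<phi> \<in> forms" "u \<in> carrier N"
  shows "(\<lambda>x. \<phi> x \<odot>\<^bsub>N\<^esub> u) \<in> module_hom R M N"
proof -
  interpret N: module R N by fact
  show ?thesis
    using module_homD[OF assms(2)] assms(3)
    by (intro module_homI) (simp_all add: N.smult_l_distr N.smult_assoc1)
qed

section \<open>Frame expansions in the second tensor power of the dual\<close>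

context graded_bialgebra_finite
begin

interpretation dual: module R "graded_dual R H"
  by (rule module_graded_dual)

text \<open>Degrees are natural numbers and add up under multiplication, so a product with a factor
  of degree above N has only parts of degree above N. The other factor is arbitrary, hence the
  reduction to homogeneous elements by \<open>zero\<close>.\<close>

lemma vanishes_above_mult:
  assumes "f \<in> forms" "vanishes_above N f"
  shows "y \<in> carrier H \<Longrightarrow> vanishes_above N (\<lambda>x. f (x \<otimes>\<^bsub>H\<^esub> y))"
    and "x \<in> carrier H \<Longrightarrow> vanishes_above N (\<lambda>y. f (x \<otimes>\<^bsub>H\<^esub> y))"
proof -
  have zero: "g z = \<zero>\<^bsub>R\<^esub>"
    if "g \<in> forms" "z \<in> carrier H" "\<And>n z. z \<in> component H n \<Longrightarrow> g z = \<zero>\<^bsub>R\<^esub>" for g z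
  proof -
    have "g z = (\<Oplus>\<^bsub>R\<^esub>n\<in>{..0}. g (graded_proj H n z))"
      using that by (intro form_eq_sum_proj) (auto simp: vanishes_above_def)
    then show ?thesis
      using that(3)[OF graded_proj_component[OF that(2)]] by simp
  qed
  have mult: "f (x \<otimes>\<^bsub>H\<^esub> y) = \<zero>\<^bsub>R\<^esub>" if "x \<in> component H m" "y \<in> component H n" "m > N \<or> n > N" for x y m n
  proof -
    have "m + n > N"
      using that(3) by auto
    then show ?thesis
      using assms(2) mult_graded[OF that(1,2)] by (auto simp: vanishes_above_def)
  qed
  show "vanishes_above N (\<lambda>x. f (x \<otimes>\<^bsub>H\<^esub> y))" if "y \<in> carrier H"
    unfolding vanishes_above_def
  proof (intro allI impI ballI)
    fix n x assume *: "n > N" "x \<in> component H n"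
    then show "f (x \<otimes>\<^bsub>H\<^esub> y) = \<zero>\<^bsub>R\<^esub>"
      using zero[OF mult_form_left[OF assms(1)] that, of x] mult component_subset by blast
  qed
  show "vanishes_above N (\<lambda>y. f (x \<otimes>\<^bsub>H\<^esub> y))" if "x \<in> carrier H"
    unfolding vanishes_above_def
  proof (intro allI impI ballI)
    fix n y assume *: "n > N" "y \<in> component H n"
    then show "f (x \<otimes>\<^bsub>H\<^esub> y) = \<zero>\<^bsub>R\<^esub>"
      using zero[OF mult_form_right[OF assms(1)] that, of y] mult component_subset by blast
  qed
qed

text \<open>
  The coefficients \<open>f (e\<^sub>i e\<^sub>j)\<close> give the existence of the comultiplication of \<open>f\<close>; the coefficients
  \<open>\<langle>T, e\<^sub>i \<otimes> e\<^sub>j\<rangle>\<close> recover a tensor \<open>T\<close> from its pairings, whence uniqueness.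
\<close>

definition frame_expansion ::
  "'i set \<Rightarrow> ('i \<Rightarrow> 'i \<Rightarrow> 'a) \<Rightarrow> ('i \<Rightarrow> 'b \<Rightarrow> 'a) \<Rightarrow> ('a, 'b \<Rightarrow> 'a) tensor" where
  "frame_expansion J c d = (\<Oplus>\<^bsub>tensor_power R (graded_dual R H) 2\<^esub>i\<in>J.
     \<Oplus>\<^bsub>tensor_power R (graded_dual R H) 2\<^esub>j\<in>J.
       c i j \<odot>\<^bsub>tensor_power R (graded_dual R H) 2\<^esub> pure_tensor R (graded_dual R H) [d i, d j])"

lemma pure_pair_closed:
  "\<lbrakk>f \<in> carrier (graded_dual R H); g \<in> carrier (graded_dual R H)\<rbrakk> \<Longrightarrow>
    pure_tensor R (graded_dual R H) [f, g] \<in> carrier (tensor_power R (graded_dual R H) 2)"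
  by (rule dual.pure_tensor_closed) (simp add: numeral_2_eq_2)

lemma frame_expansion_cong:
  assumes "d \<in> J \<rightarrow> carrier (graded_dual R H)"
    and "\<And>i j. \<lbrakk>i \<in> J; j \<in> J\<rbrakk> \<Longrightarrow> c i j \<in> carrier R" "\<And>i j. \<lbrakk>i \<in> J; j \<in> J\<rbrakk> \<Longrightarrow> c i j = c' i j"
  shows "frame_expansion J c d = frame_expansion J c' d"
proof -
  interpret T: module R "tensor_power R (graded_dual R H) 2"
    by (rule dual.module_tensor_power)
  have "c' i j \<in> carrier R" if "i \<in> J" "j \<in> J" for i j
    using assms(2,3) that by metis
  then show ?thesis
    unfolding frame_expansion_def using assms(3) pure_pair_closed funcset_mem[OF assms(1)]
    by (intro T.finsum_cong' HOL.refl T.finsum_closed funcsetI T.smult_closed) auto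
qed

text \<open>The pairing is the sum of all
  \<open>d i x \<otimes> (d j y \<otimes> f (e i \<otimes> e j))\<close>. It collapses in two steps:
  the frame expands \<open>f (e i \<otimes> _)\<close> at \<open>y\<close>, and then
  \<open>f (_ \<otimes> y)\<close> at \<open>x\<close>. One degree bound suffices by
  \<open>vanishes_above_mult\<close>.\<close>

lemma form_lift_frame_expansion:
  assumes f: "f \<in> forms" "vanishes_above N f" and frame: "dual_frame N J e d"
    and x: "x \<in> carrier H" and y: "y \<in> carrier H"
  shows "frame_expansion J (\<lambda>i j. f (e i \<otimes>\<^bsub>H\<^esub> e j)) d \<in> carrier (tensor_power R (graded_dual R H) 2)"
    and "form_lift R (evals [x, y]) (frame_expansion J (\<lambda>i j. f (e i \<otimes>\<^bsub>H\<^esub> e j)) d) = f (x \<otimes>\<^bsub>H\<^esub> y)"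
proof -
  let ?T = "tensor_power R (graded_dual R H) 2"
  interpret T: module R ?T
    by (rule dual.module_tensor_power)
  have J: "finite J" and e: "\<And>j. j \<in> J \<Longrightarrow> e j \<in> carrier H"
    and d: "\<And>j. j \<in> J \<Longrightarrow> d j \<in> carrier (graded_dual R H)"
    using frame by (auto simp: dual_frame_def)
  note expand = dual_frame_expand[OF frame]
  note f_val = module_homD(1)[OF f(1), simplified]
  have d_val: "d j z \<in> carrier R" if "j \<in> J" "z \<in> carrier H" for j z
    using module_homD(1)[OF graded_dual_form[OF d[OF that(1)]] that(2)] by simp
  let ?u = "\<lambda>i j. f (e i \<otimes>\<^bsub>H\<^esub> e j) \<odot>\<^bsub>?T\<^esub> pure_tensor R (graded_dual R H) [d i, d j]"
  have u: "?u i j \<in> carrier ?T" if "i \<in> J" "j \<in> J" for i j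
    using that e d f_val by (intro T.smult_closed pure_pair_closed) auto
  then show "frame_expansion J (\<lambda>i j. f (e i \<otimes>\<^bsub>H\<^esub> e j)) d \<in> carrier ?T"
    unfolding frame_expansion_def by (intro T.finsum_closed funcsetI) auto
  have hom: "form_lift R (evals [x, y]) \<in> module_hom R ?T (ring_as_module R)"
    using dual.form_lift_hom[OF evals_forms[of "[x, y]" 2]] x y by (simp add: numeral_2_eq_2)
  have u_val: "form_lift R (evals [x, y]) (?u i j) = d i x \<otimes>\<^bsub>R\<^esub> (d j y \<otimes>\<^bsub>R\<^esub> f (e i \<otimes>\<^bsub>H\<^esub> e j))"
    if "i \<in> J" "j \<in> J" for i j
  proof -
    have "form_lift R (evals [x, y]) (?u i j) = f (e i \<otimes>\<^bsub>H\<^esub> e j) \<otimes>\<^bsub>R\<^esub> (d i x \<otimes>\<^bsub>R\<^esub> d j y)"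
      using module_homD(3)[OF hom _ pure_pair_closed[OF d d], of "f (e i \<otimes>\<^bsub>H\<^esub> e j)" i j]
        form_lift_evals_pair[OF x y d d, of i j] that e f_val by simp
    then show ?thesis
      using that d_val x y e f_val by (simp add: R.m_ac)
  qed
  have inner: "(\<Oplus>\<^bsub>R\<^esub>j\<in>J. form_lift R (evals [x, y]) (?u i j)) = d i x \<otimes>\<^bsub>R\<^esub> f (e i \<otimes>\<^bsub>H\<^esub> y)"
    if i: "i \<in> J" for i
  proof -
    have "(\<Oplus>\<^bsub>R\<^esub>j\<in>J. form_lift R (evals [x, y]) (?u i j)) =
        (\<Oplus>\<^bsub>R\<^esub>j\<in>J. d i x \<otimes>\<^bsub>R\<^esub> (d j y \<otimes>\<^bsub>R\<^esub> f (e i \<otimes>\<^bsub>H\<^esub> e j)))"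
      using i u_val d_val x y e f_val by (intro R.finsum_cong' HOL.refl funcsetI) auto
    also have "\<dots> = d i x \<otimes>\<^bsub>R\<^esub> (\<Oplus>\<^bsub>R\<^esub>j\<in>J. d j y \<otimes>\<^bsub>R\<^esub> f (e i \<otimes>\<^bsub>H\<^esub> e j))"
      using i d_val x y e f_val by (intro R.finsum_rdistr[symmetric] J funcsetI) auto
    also have "(\<Oplus>\<^bsub>R\<^esub>j\<in>J. d j y \<otimes>\<^bsub>R\<^esub> f (e i \<otimes>\<^bsub>H\<^esub> e j)) = f (e i \<otimes>\<^bsub>H\<^esub> y)"
      using expand[OF mult_form_left[OF f(1) e[OF i]] vanishes_above_mult(2)[OF f e[OF i]] y] by simp
    finally show ?thesis .
  qed
  have "form_lift R (evals [x, y]) (frame_expansion J (\<lambda>i j. f (e i \<otimes>\<^bsub>H\<^esub> e j)) d) =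
      (\<Oplus>\<^bsub>R\<^esub>i\<in>J. form_lift R (evals [x, y]) (\<Oplus>\<^bsub>?T\<^esub>j\<in>J. ?u i j))"
    unfolding frame_expansion_def
    using module_hom_finsum[OF T.module_axioms module_R hom, of "\<lambda>i. \<Oplus>\<^bsub>?T\<^esub>j\<in>J. ?u i j" J] u
    by (simp add: Pi_def T.finsum_closed)
  also have "\<dots> = (\<Oplus>\<^bsub>R\<^esub>i\<in>J. d i x \<otimes>\<^bsub>R\<^esub> f (e i \<otimes>\<^bsub>H\<^esub> y))"
  proof (intro R.finsum_cong' HOL.refl funcsetI)
    fix i assume i: "i \<in> J"
    show "d i x \<otimes>\<^bsub>R\<^esub> f (e i \<otimes>\<^bsub>H\<^esub> y) \<in> carrier R"
      using i d_val x y e f_val by simp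
    show "form_lift R (evals [x, y]) (\<Oplus>\<^bsub>?T\<^esub>j\<in>J. ?u i j) = d i x \<otimes>\<^bsub>R\<^esub> f (e i \<otimes>\<^bsub>H\<^esub> y)"
      using module_hom_finsum[OF T.module_axioms module_R hom, of "?u i" J] u[OF i] inner[OF i]
      by (simp add: Pi_def)
  qed
  also have "\<dots> = f (x \<otimes>\<^bsub>H\<^esub> y)"
    using expand[OF mult_form_right[OF f(1) y] vanishes_above_mult(1)[OF f y] x] by simp
  finally show "form_lift R (evals [x, y]) (frame_expansion J (\<lambda>i j. f (e i \<otimes>\<^bsub>H\<^esub> e j)) d) =
      f (x \<otimes>\<^bsub>H\<^esub> y)" .
qed

lemma pure_pair_frame_expansion:
  assumes frame: "dual_frame N J e d"
    and f: "f \<in> carrier (graded_dual R H)" "vanishes_above N f"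
    and g: "g \<in> carrier (graded_dual R H)" "vanishes_above N g"
  shows "frame_expansion J (\<lambda>i j. form_lift R (evals [e i, e j]) (pure_tensor R (graded_dual R H) [f, g])) d =
    pure_tensor R (graded_dual R H) [f, g]"
proof -
  let ?D = "graded_dual R H" and ?T = "tensor_power R (graded_dual R H) 2"
  interpret T: module R ?T
    by (rule dual.module_tensor_power)
  have J: "finite J" and e: "\<And>j. j \<in> J \<Longrightarrow> e j \<in> carrier H"
    and d: "\<And>j. j \<in> J \<Longrightarrow> d j \<in> carrier ?D"
    using frame by (auto simp: dual_frame_def)
  have val: "k x \<in> carrier R" if "k \<in> carrier ?D" "x \<in> carrier H" for k x
    using module_homD(1)[OF graded_dual_form[OF that(1)] that(2)] by simp
  \<comment> \<open>The frame identity read in the other direction: as an equation in D it expresses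
    a form through the \<open>d j\<close>, with coefficients its values at the
    \<open>e j\<close>.\<close>
  have expand: "(\<Oplus>\<^bsub>?D\<^esub>j\<in>J. k (e j) \<odot>\<^bsub>?D\<^esub> d j) = k"
    if k: "k \<in> carrier ?D" "vanishes_above N k" for k
  proof (rule graded_dual_eqI[OF _ k(1)])
    have closed: "(\<lambda>j. k (e j) \<odot>\<^bsub>?D\<^esub> d j) \<in> J \<rightarrow> carrier ?D"
      using e d val[OF k(1)] by auto
    then show "(\<Oplus>\<^bsub>?D\<^esub>j\<in>J. k (e j) \<odot>\<^bsub>?D\<^esub> d j) \<in> carrier ?D"
      by (rule dual.M.finsum_closed)
    fix x assume x: "x \<in> carrier H"
    have "(\<Oplus>\<^bsub>?D\<^esub>j\<in>J. k (e j) \<odot>\<^bsub>?D\<^esub> d j) x = (\<Oplus>\<^bsub>R\<^esub>j\<in>J. (k (e j) \<odot>\<^bsub>?D\<^esub> d j) x)"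
      by (rule finsum_graded_dual[OF closed x])
    also have "\<dots> = (\<Oplus>\<^bsub>R\<^esub>j\<in>J. d j x \<otimes>\<^bsub>R\<^esub> k (e j))"
      using x e val[OF d] val[OF k(1)]
      by (intro R.finsum_cong' HOL.refl funcsetI) (auto simp: graded_dual_simps(6) R.m_comm)
    also have "\<dots> = k x"
      by (rule dual_frame_expand[OF frame graded_dual_form[OF k(1)] k(2) x, symmetric])
    finally show "(\<Oplus>\<^bsub>?D\<^esub>j\<in>J. k (e j) \<odot>\<^bsub>?D\<^esub> d j) x = k x" .
  qed
  have pair: "[k, l] \<in> tuples ?D 2" if "k \<in> carrier ?D" "l \<in> carrier ?D" for k l
    using that by (simp add: numeral_2_eq_2)
  have left: "(\<lambda>k. pure_tensor R ?D [k, l]) \<in> module_hom R ?D ?T" if "l \<in> carrier ?D" for l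
    using multilinear_hom[OF dual.multilinear_pure_tensor pair[OF that that], of 0] by simp
  have right: "(\<lambda>l. pure_tensor R ?D [k, l]) \<in> module_hom R ?D ?T" if "k \<in> carrier ?D" for k
    using multilinear_hom[OF dual.multilinear_pure_tensor pair[OF that that], of 1] by simp
  note sum_left = module_hom_finsum[OF dual.module_axioms T.module_axioms left]
  note sum_right = module_hom_finsum[OF dual.module_axioms T.module_axioms right]
  have "pure_tensor R ?D [f, g] = pure_tensor R ?D [\<Oplus>\<^bsub>?D\<^esub>i\<in>J. f (e i) \<odot>\<^bsub>?D\<^esub> d i, g]"
    by (simp only: expand[OF f])
  also have "\<dots> = (\<Oplus>\<^bsub>?T\<^esub>i\<in>J. pure_tensor R ?D [f (e i) \<odot>\<^bsub>?D\<^esub> d i, g])"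
    using e d val[OF f(1)] by (intro sum_left[OF g(1)]) auto
  also have "\<dots> = (\<Oplus>\<^bsub>?T\<^esub>i\<in>J. \<Oplus>\<^bsub>?T\<^esub>j\<in>J. (f (e i) \<otimes>\<^bsub>R\<^esub> g (e j)) \<odot>\<^bsub>?T\<^esub> pure_tensor R ?D [d i, d j])"
  proof (rule T.finsum_cong'[OF HOL.refl])
    show "(\<lambda>i. \<Oplus>\<^bsub>?T\<^esub>j\<in>J. (f (e i) \<otimes>\<^bsub>R\<^esub> g (e j)) \<odot>\<^bsub>?T\<^esub> pure_tensor R ?D [d i, d j]) \<in> J \<rightarrow> carrier ?T"
      using e d val[OF f(1)] val[OF g(1)] pure_pair_closed by (intro funcsetI T.finsum_closed) auto
    fix i assume i: "i \<in> J"
    have "pure_tensor R ?D [f (e i) \<odot>\<^bsub>?D\<^esub> d i, g] = f (e i) \<odot>\<^bsub>?T\<^esub> pure_tensor R ?D [d i, g]"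
      using module_homD(3)[OF left[OF g(1)]] val[OF f(1) e[OF i]] d[OF i] by simp
    also have "pure_tensor R ?D [d i, g] = pure_tensor R ?D [d i, \<Oplus>\<^bsub>?D\<^esub>j\<in>J. g (e j) \<odot>\<^bsub>?D\<^esub> d j]"
      by (simp only: expand[OF g])
    also have "\<dots> = (\<Oplus>\<^bsub>?T\<^esub>j\<in>J. pure_tensor R ?D [d i, g (e j) \<odot>\<^bsub>?D\<^esub> d j])"
      using e d val[OF g(1)] by (intro sum_right[OF d[OF i]]) auto
    also have "f (e i) \<odot>\<^bsub>?T\<^esub> \<dots> = (\<Oplus>\<^bsub>?T\<^esub>j\<in>J. f (e i) \<odot>\<^bsub>?T\<^esub> pure_tensor R ?D [d i, g (e j) \<odot>\<^bsub>?D\<^esub> d j])"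
      using e d val[OF g(1)] val[OF f(1) e[OF i]] i pure_pair_closed
      by (intro T.finsum_smult_ldistr J) auto
    also have "\<dots> = (\<Oplus>\<^bsub>?T\<^esub>j\<in>J. (f (e i) \<otimes>\<^bsub>R\<^esub> g (e j)) \<odot>\<^bsub>?T\<^esub> pure_tensor R ?D [d i, d j])"
    proof (rule T.finsum_cong'[OF HOL.refl])
      fix j assume j: "j \<in> J"
      show "f (e i) \<odot>\<^bsub>?T\<^esub> pure_tensor R ?D [d i, g (e j) \<odot>\<^bsub>?D\<^esub> d j] =
          (f (e i) \<otimes>\<^bsub>R\<^esub> g (e j)) \<odot>\<^bsub>?T\<^esub> pure_tensor R ?D [d i, d j]"
        using module_homD(3)[OF right[OF d[OF i]] val[OF g(1) e[OF j]] d[OF j]]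
          T.smult_assoc1[OF val[OF f(1) e[OF i]] val[OF g(1) e[OF j]] pure_pair_closed[OF d[OF i] d[OF j]]]
        by simp
    qed (use e d i val[OF f(1)] val[OF g(1)] pure_pair_closed in auto)
    finally show "pure_tensor R ?D [f (e i) \<odot>\<^bsub>?D\<^esub> d i, g] =
        (\<Oplus>\<^bsub>?T\<^esub>j\<in>J. (f (e i) \<otimes>\<^bsub>R\<^esub> g (e j)) \<odot>\<^bsub>?T\<^esub> pure_tensor R ?D [d i, d j])" .
  qed
  also have "\<dots> = frame_expansion J (\<lambda>i j. f (e i) \<otimes>\<^bsub>R\<^esub> g (e j)) d"
    by (simp add: frame_expansion_def)
  also have "\<dots> = frame_expansion J (\<lambda>i j. form_lift R (evals [e i, e j]) (pure_tensor R ?D [f, g])) d"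
    using e d val[OF f(1)] val[OF g(1)]
    by (intro frame_expansion_cong) (auto simp: form_lift_evals_pair[OF _ _ f(1) g(1), simplified])
  finally show ?thesis by simp
qed

text \<open>Linearity in the tensor reduces the recovery of a general tensor to that of pure
  ones.\<close>

lemma frame_expansion_hom:
  assumes "dual_frame N J e d"
  shows "(\<lambda>T. frame_expansion J (\<lambda>i j. form_lift R (evals [e i, e j]) T) d) \<in>
    module_hom R (tensor_power R (graded_dual R H) 2) (tensor_power R (graded_dual R H) 2)"
proof -
  let ?T = "tensor_power R (graded_dual R H) 2"
  interpret T: module R ?T
    by (rule dual.module_tensor_power)
  have "form_lift R (evals [e i, e j]) \<in> T.forms" if "i \<in> J" "j \<in> J" for i j
    using dual.form_lift_hom[OF evals_forms[of "[e i, e j]" 2]] that assms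
    by (auto simp: numeral_2_eq_2 dual_frame_def)
  then show ?thesis
    unfolding frame_expansion_def using assms
    by (intro finsum_hom T.module_axioms T.scale_fixed_hom pure_pair_closed)
      (auto simp: dual_frame_def)
qed

text \<open>A representative involves only finitely many forms, so some degree bounds them all. The
  claim covers every larger cutoff in order that thresholds, here of head and tail and later of two
  tensors, can be combined.\<close>

lemma tensor_frame_expansion:
  assumes "T \<in> carrier (tensor_power R (graded_dual R H) 2)"
  shows "\<exists>L. \<forall>N\<ge>L. \<forall>(J :: 'i set) e d. dual_frame N J e d \<longrightarrow>
    frame_expansion J (\<lambda>i j. form_lift R (evals [e i, e j]) T) d = T"
proof -
  let ?D = "graded_dual R H" and ?T = "tensor_power R (graded_dual R H) 2"
  interpret T: module R ?T
    by (rule dual.module_tensor_power)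
  obtain t where t: "t \<in> formal_sums R ?D 2" "T = tensor_class R ?D 2 t"
    using assms by (rule dual.tensor_classE)
  have "\<exists>L. \<forall>N\<ge>L. \<forall>(J :: 'i set) e d. dual_frame N J e d \<longrightarrow>
    frame_expansion J (\<lambda>i j. form_lift R (evals [e i, e j]) (tensor_class R ?D 2 t)) d = tensor_class R ?D 2 t"
    using t(1)
  proof (induction t)
    case Nil
    show ?case
      using module_hom_zero[OF T.module_axioms T.module_axioms frame_expansion_hom]
      unfolding dual.tensor_zero_class by blast
  next
    case (Cons p t)
    have t_mem: "t \<in> formal_sums R ?D 2"
      using Cons.prems by simp
    obtain L where L: "\<And>N (J :: 'i set) e d. \<lbrakk>N \<ge> L; dual_frame N J e d\<rbrakk> \<Longrightarrow>
        frame_expansion J (\<lambda>i j. form_lift R (evals [e i, e j]) (tensor_class R ?D 2 t)) d = tensor_class R ?D 2 t"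
      using Cons.IH[OF t_mem] by blast
    obtain c f g where p: "p = (c, [f, g])" "c \<in> carrier R" "f \<in> carrier ?D" "g \<in> carrier ?D"
      using Cons.prems by (cases p) (auto simp: tuples_def numeral_2_eq_2 length_Suc_conv)
    obtain N1 N2 where N: "vanishes_above N1 f" "vanishes_above N2 g"
      using p by (auto simp: carrier_graded_dual)
    have fg: "[f, g] \<in> tuples ?D 2"
      using p by (simp add: numeral_2_eq_2)
    have t: "tensor_class R ?D 2 t \<in> carrier ?T"
      using t_mem by simp
    have split: "tensor_class R ?D 2 (p # t) =
        c \<odot>\<^bsub>?T\<^esub> pure_tensor R ?D [f, g] \<oplus>\<^bsub>?T\<^esub> tensor_class R ?D 2 t"
      using Cons.prems p fg
      by (simp add: dual.pure_tensor_class[OF fg] dual.tensor_smult_class dual.tensor_add_class)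
    have "frame_expansion J (\<lambda>i j. form_lift R (evals [e i, e j]) (tensor_class R ?D 2 (p # t))) d =
        tensor_class R ?D 2 (p # t)"
      \<comment> \<open>The cutoff has to exceed the threshold of the tail and the bounds of both
        forms in the head.\<close>
      if *: "N \<ge> max L (max N1 N2)" "dual_frame N J e d" for N e d and J :: "'i set"
    proof -
      note hom = frame_expansion_hom[OF *(2)]
      have "frame_expansion J (\<lambda>i j. form_lift R (evals [e i, e j]) (pure_tensor R ?D [f, g])) d =
          pure_tensor R ?D [f, g]"
        using *(1) p N
        by (intro pure_pair_frame_expansion[OF *(2)])
          (auto intro: vanishes_above_mono)
      then show ?thesis
        unfolding split
        using module_homD(2)[OF hom T.smult_closed[OF p(2) pure_pair_closed[OF p(3,4)]] t]
          module_homD(3)[OF hom p(2) pure_pair_closed[OF p(3,4)]] L[OF _ *(2)] *(1)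
        by simp
    qed
    then show ?case by blast
  qed
  then show ?thesis
    unfolding t(2) .
qed

text \<open>The coefficients of a frame expansion are pairings with pairs of points. A frame whose
  cutoff is large enough for both tensors therefore rebuilds both from the same
  coefficients.\<close>

lemma tensor_square_eqI:
  assumes "S \<in> carrier (tensor_power R (graded_dual R H) 2)" "T \<in> carrier (tensor_power R (graded_dual R H) 2)"
    and "\<And>x y. \<lbrakk>x \<in> carrier H; y \<in> carrier H\<rbrakk> \<Longrightarrow> form_lift R (evals [x, y]) S = form_lift R (evals [x, y]) T"
  shows "S = T"
proof -
  obtain L where L: "\<And>N (J :: (nat \<times> 'b) set) e d. \<lbrakk>N \<ge> L; dual_frame N J e d\<rbrakk> \<Longrightarrow>
      frame_expansion J (\<lambda>i j. form_lift R (evals [e i, e j]) S) d = S"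
    using tensor_frame_expansion[OF assms(1)] by blast
  obtain K where K: "\<And>N (J :: (nat \<times> 'b) set) e d. \<lbrakk>N \<ge> K; dual_frame N J e d\<rbrakk> \<Longrightarrow>
      frame_expansion J (\<lambda>i j. form_lift R (evals [e i, e j]) T) d = T"
    using tensor_frame_expansion[OF assms(2)] by blast
  obtain J :: "(nat \<times> 'b) set" and e d where frame: "dual_frame (max L K) J e d"
    using dual_frame_exists by blast
  have "frame_expansion J (\<lambda>i j. form_lift R (evals [e i, e j]) S) d =
      frame_expansion J (\<lambda>i j. form_lift R (evals [e i, e j]) T) d"
  proof (rule frame_expansion_cong)
    show "d \<in> J \<rightarrow> carrier (graded_dual R H)"
      using frame by (simp add: dual_frame_def)
    fix i j assume "i \<in> J" "j \<in> J"
    then have e: "e i \<in> carrier H" "e j \<in> carrier H"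
      using frame by (auto simp: dual_frame_def)
    then show "form_lift R (evals [e i, e j]) S = form_lift R (evals [e i, e j]) T"
      by (rule assms(3))
    show "form_lift R (evals [e i, e j]) S \<in> carrier R"
      using e assms(1) dual.form_lift_closed[OF evals_forms[of "[e i, e j]" 2]]
      by (simp add: numeral_2_eq_2)
  qed
  then show ?thesis
    using L[OF _ frame] K[OF _ frame] by simp
qed

lemma tensor_pairing_pure:
  assumes "F \<in> carrier (tensor_power R (graded_dual R H) 2)" "x \<in> carrier H" "y \<in> carrier H"
  shows "tensor_pairing R F (pure_tensor R H [x, y]) = form_lift R (evals [x, y]) F"
  unfolding tensor_pairing_def
proof (rule dual.tensor_lift_cong[OF _ assms(1)])
  fix fs assume fs: "fs \<in> tuples (graded_dual R H) 2"
  then have "set fs \<subseteq> forms" "length fs = 2"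
    using graded_dual_form by (auto simp: tuples_def)
  then show "tensor_lift (ring_as_module R) (pure_pairing R fs) (pure_tensor R H [x, y]) =
      pure_pairing R (evals [x, y]) fs"
    using form_lift_pure[of fs "[x, y]"] pure_pairing_evals[of fs "[x, y]" R] assms(2,3)
    by (simp add: numeral_2_eq_2)
qed

lemma comult_graded_dual:
  assumes f: "f \<in> carrier (graded_dual R H)"
  shows "comult (graded_dual R H) f \<in> carrier (tensor_power R (graded_dual R H) 2)"
    and "\<lbrakk>x \<in> carrier H; y \<in> carrier H\<rbrakk> \<Longrightarrow>
      form_lift R (evals [x, y]) (comult (graded_dual R H) f) = f (x \<otimes>\<^bsub>H\<^esub> y)"
proof -
  define P where "P F \<longleftrightarrow> F \<in> carrier (tensor_power R (graded_dual R H) 2) \<and>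
    (\<forall>x\<in>carrier H. \<forall>y\<in>carrier H. tensor_pairing R F (pure_tensor R H [x, y]) = f (x \<otimes>\<^bsub>H\<^esub> y))" for F
  obtain N where N: "vanishes_above N f"
    using f by (auto simp: carrier_graded_dual)
  obtain J :: "(nat \<times> 'b) set" and e d where frame: "dual_frame N J e d"
    using dual_frame_exists by blast
  note expansion = form_lift_frame_expansion[OF graded_dual_form[OF f] N frame]
  have "P (frame_expansion J (\<lambda>i j. f (e i \<otimes>\<^bsub>H\<^esub> e j)) d)"
    \<comment> \<open>The membership fact inherits two points of H from the shared assumptions; the
      unit is supplied for both.\<close>
    unfolding P_def using expansion(1)[of "\<one>\<^bsub>H\<^esub>" "\<one>\<^bsub>H\<^esub>"] expansion(2) tensor_pairing_pure by simp
  moreover have "F = G" if "P F" "P G" for F G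
    using that by (intro tensor_square_eqI) (auto simp: P_def tensor_pairing_pure[simplified])
  ultimately have "\<exists>!F. P F" by blast
  then have "P (THE F. P F)" by (rule theI')
  \<comment> \<open>The definition speaks of tensors over \<open>graded_dual_algebra\<close>, so the
    tensor power in \<open>P\<close> is rewritten back to that record.\<close>
  moreover have "comult (graded_dual R H) f = (THE F. P F)"
    by (simp add: P_def graded_dual_tensor_power[symmetric])
      (simp add: graded_dual_def module.extend_def graded_bialgebra.fields_def)
  ultimately have P: "P (comult (graded_dual R H) f)" by simp
  then show "comult (graded_dual R H) f \<in> carrier (tensor_power R (graded_dual R H) 2)"
    by (simp add: P_def)
  show "form_lift R (evals [x, y]) (comult (graded_dual R H) f) = f (x \<otimes>\<^bsub>H\<^esub> y)"
    if "x \<in> carrier H" "y \<in> carrier H"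
    using P tensor_pairing_pure[OF _ that] that unfolding P_def by metis
qed

text \<open>The recursion evaluates the first factor of the comultiplication at \<open>h\<close>
  and, by induction, the second at the product of the remaining points. What is left is one pairing
  of the comultiplication with two points. The form varies in the induction because the hypothesis
  is applied to the second factor.\<close>

lemma iter_comult_graded_dual:
  assumes "f \<in> carrier (graded_dual R H)"
  shows "iter_comult R (graded_dual R H) k f \<in> carrier (tensor_power R (graded_dual R H) k)"
    and "hs \<in> tuples H k \<Longrightarrow> form_lift R (evals hs) (iter_comult R (graded_dual R H) k f) =
      f (foldr (\<lambda>x y. x \<otimes>\<^bsub>H\<^esub> y) hs \<one>\<^bsub>H\<^esub>)"
proof -
  have "iter_comult R (graded_dual R H) k f \<in> carrier (tensor_power R (graded_dual R H) k) \<and>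
    (\<forall>hs\<in>tuples H k. form_lift R (evals hs) (iter_comult R (graded_dual R H) k f) =
      f (foldr (\<lambda>x y. x \<otimes>\<^bsub>H\<^esub> y) hs \<one>\<^bsub>H\<^esub>))"
    using assms
  proof (induction k arbitrary: f)
    case 0
    have one: "f \<one>\<^bsub>H\<^esub> \<in> carrier R"
      using module_homD(1)[OF graded_dual_form[OF 0]] by simp
    have pure: "pure_tensor R (graded_dual R H) [] \<in> carrier (tensor_power R (graded_dual R H) 0)"
      by (rule dual.pure_tensor_closed) simp
    interpret T: module R "tensor_power R (graded_dual R H) 0"
      by (rule dual.module_tensor_power)
    show ?case
      using one pure module_homD(3)[OF dual.form_lift_hom[of "[]"], of "f \<one>\<^bsub>H\<^esub>"
          "pure_tensor R (graded_dual R H) []"] dual.form_lift_pure[of "[]" "[]"]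
      by (simp add: graded_dual_simps(7) tuples_def)
  next
    case (Suc k)
    note comult = comult_graded_dual[OF Suc.prems]
    note maps = dual.tensor_maps_Suc[where \<psi> = "iter_comult R (graded_dual R H) k",
        OF Suc.IH[THEN conjunct1] comult(1)]
    have "form_lift R (evals hs) (iter_comult R (graded_dual R H) (Suc k) f) =
        f (foldr (\<lambda>x y. x \<otimes>\<^bsub>H\<^esub> y) hs \<one>\<^bsub>H\<^esub>)" if hs: "hs \<in> tuples H (Suc k)" for hs
    proof -
      obtain h hs' where h: "hs = h # hs'" "h \<in> carrier H" "hs' \<in> tuples H k"
        using hs by (cases hs) (auto simp: tuples_def)
      let ?p = "foldr (\<lambda>x y. x \<otimes>\<^bsub>H\<^esub> y) hs' \<one>\<^bsub>H\<^esub>"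
      note p = prod_list_closed[OF h(3)]
      have "form_lift R (evals hs) (iter_comult R (graded_dual R H) (Suc k) f) =
          tensor_lift (ring_as_module R) (\<lambda>fs. (fs ! 0) h \<otimes>\<^bsub>R\<^esub>
            form_lift R (evals hs') (iter_comult R (graded_dual R H) k (fs ! 1))) (comult (graded_dual R H) f)"
        using maps(2)[OF _ eval_hom[OF h(2)] evals_forms[OF h(3)]] h(1) length_in_tuples[OF h(3)] by simp
      also have "\<dots> = form_lift R (evals [h, ?p]) (comult (graded_dual R H) f)"
      proof (rule dual.tensor_lift_cong[OF _ comult(1)])
        fix fs assume "fs \<in> tuples (graded_dual R H) 2"
        then obtain f' g' where fs: "fs = [f', g']" "f' \<in> carrier (graded_dual R H)"
          "g' \<in> carrier (graded_dual R H)"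
          by (auto simp: tuples_def numeral_2_eq_2 length_Suc_conv)
        then show "(fs ! 0) h \<otimes>\<^bsub>R\<^esub>
            form_lift R (evals hs') (iter_comult R (graded_dual R H) k (fs ! 1)) =
            pure_pairing R (evals [h, ?p]) fs"
          using Suc.IH[OF fs(3)] h(3) module_homD(1)[OF graded_dual_form[OF fs(3)] p] by simp
      qed
      also have "\<dots> = f (h \<otimes>\<^bsub>H\<^esub> ?p)"
        by (rule comult(2)[OF h(2) p])
      finally show ?thesis
        by (simp add: h(1))
    qed
    then show ?case
      using maps(1) by simp
  qed
  then show "iter_comult R (graded_dual R H) k f \<in> carrier (tensor_power R (graded_dual R H) k)"
    and "hs \<in> tuples H k \<Longrightarrow> form_lift R (evals hs) (iter_comult R (graded_dual R H) k f) =
      f (foldr (\<lambda>x y. x \<otimes>\<^bsub>H\<^esub> y) hs \<one>\<^bsub>H\<^esub>)"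
    by auto
qed

end

section \<open>The dual of the endomorphisms\<close>

text \<open>A product over an index set, unlike a fold over a list, can be reindexed along a
  permutation.\<close>

lemma (in cring) foldr_mult_finprod:
  "set xs \<subseteq> carrier R \<Longrightarrow> foldr (\<lambda>a b. a \<otimes> b) xs \<one> = finprod R (\<lambda>i. xs ! i) {..<length xs}"
proof (induction xs)
  case (Cons x xs)
  have "finprod R (\<lambda>i. (x # xs) ! i) {..<Suc (length xs)} =
      finprod R (\<lambda>i. (x # xs) ! i) (insert 0 (Suc ` {..<length xs}))"
    by (simp add: lessThan_Suc_eq_insert_0)
  also have "\<dots> = x \<otimes> finprod R (\<lambda>i. (x # xs) ! i) (Suc ` {..<length xs})"
    using Cons.prems by (subst finprod_insert) auto
  also have "finprod R (\<lambda>i. (x # xs) ! i) (Suc ` {..<length xs}) = finprod R (\<lambda>i. xs ! i) {..<length xs}"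
    using Cons.prems by (subst finprod_reindex) auto
  finally show ?case
    using Cons by simp
qed simp

lemma (in cring) pure_pairing_finprod:
  assumes "length es = length hs" "\<And>i. i < length hs \<Longrightarrow> (es ! i) (hs ! i) \<in> carrier R"
  shows "pure_pairing R es hs = finprod R (\<lambda>i. (es ! i) (hs ! i)) {..<length hs}"
proof -
  have "set (map2 (\<lambda>f h. f h) es hs) \<subseteq> carrier R"
    using assms by (auto simp: set_zip)
  then have "pure_pairing R es hs =
      finprod R (\<lambda>i. map2 (\<lambda>f h. f h) es hs ! i) {..<length (map2 (\<lambda>f h. f h) es hs)}"
    unfolding pure_pairing_def by (rule foldr_mult_finprod)
  also have "\<dots> = finprod R (\<lambda>i. (es ! i) (hs ! i)) {..<length hs}"
    using assms by (intro finprod_cong') auto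
  finally show ?thesis .
qed

text \<open>An exchange of finite sums: both sides are the double sum of the values of
  \<open>P\<close> weighted by the coefficients of \<open>s\<close> and \<open>t\<close>.\<close>

lemma (in module) formal_eval_swap:
  assumes "module R N" "s \<in> formal_sums R M k" "t \<in> formal_sums R N l"
    and "\<And>xs ys. \<lbrakk>xs \<in> tuples M k; ys \<in> tuples N l\<rbrakk> \<Longrightarrow> P xs ys \<in> carrier R"
  shows "formal_eval (ring_as_module R) (\<lambda>xs. formal_eval (ring_as_module R) (P xs) t) s =
    formal_eval (ring_as_module R) (\<lambda>ys. formal_eval (ring_as_module R) (\<lambda>xs. P xs ys) s) t"
  using assms(2)
proof (induction s)
  interpret N: module R N by fact
  note closedM = formal_eval_closed[OF module_R, simplified]
    and closedN = N.formal_eval_closed[OF module_R, simplified]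
  {
    case Nil
    show ?case
      using assms(3) by (induction t) simp_all
  next
    case (Cons p s)
    then have p: "fst p \<in> carrier R" "snd p \<in> tuples M k" and s: "s \<in> formal_sums R M k"
      by auto
    have "formal_eval (ring_as_module R)
        (\<lambda>ys. fst p \<otimes> P (snd p) ys \<oplus> formal_eval (ring_as_module R) (\<lambda>xs. P xs ys) s) t =
      fst p \<otimes> formal_eval (ring_as_module R) (P (snd p)) t \<oplus>
        formal_eval (ring_as_module R) (\<lambda>ys. formal_eval (ring_as_module R) (\<lambda>xs. P xs ys) s) t"
      using assms(3)
    proof (induction t)
      case Nil
      then show ?case using p by simp
    next
      case (Cons q t)
      have "P (snd p) (snd q) \<in> carrier R" "formal_eval (ring_as_module R) (P (snd p)) t \<in> carrier R"
        "formal_eval (ring_as_module R) (\<lambda>xs. P xs (snd q)) s \<in> carrier R"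
        "formal_eval (ring_as_module R) (\<lambda>ys. formal_eval (ring_as_module R) (\<lambda>xs. P xs ys) s) t \<in> carrier R"
        using Cons.prems p s assms(4) by (auto intro!: closedM closedN)
      then show ?case
        using Cons p by (simp add: R.r_distr R.m_lcomm R.a_ac)
    qed
    then show ?case
      using Cons.IH[OF s] by simp
  }
qed

text \<open>The representative of a tensor is chosen independently of the function being lifted, so
  both sides use the same pair of formal sums.\<close>

lemma (in module) tensor_lift_swap:
  assumes "module R N" "S \<in> carrier (tensor_power R M k)" "T \<in> carrier (tensor_power R N l)"
    and "\<And>xs ys. \<lbrakk>xs \<in> tuples M k; ys \<in> tuples N l\<rbrakk> \<Longrightarrow> P xs ys \<in> carrier R"
  shows "tensor_lift (ring_as_module R) (\<lambda>xs. tensor_lift (ring_as_module R) (P xs) T) S =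
    tensor_lift (ring_as_module R) (\<lambda>ys. tensor_lift (ring_as_module R) (\<lambda>xs. P xs ys) S) T"
proof -
  interpret N: module R N by fact
  show ?thesis
    unfolding tensor_lift_def
    using formal_eval_swap[OF assms(1) tensor_some_formal_sum[OF assms(2)]
        N.tensor_some_formal_sum[OF assms(3)] assms(4)] .
qed

text \<open>Zero, sums and multiples in the dual are computed pointwise. No closure of
  \<open>\<phi>\<close> is involved, so this applies directly to iterated convolution
  products.\<close>

lemma formal_eval_graded_dual:
  "h \<in> carrier H \<Longrightarrow> formal_eval (graded_dual R H) \<phi> t h =
    formal_eval (ring_as_module R) (\<lambda>fs. \<phi> fs h) t"
  by (induction t) (simp_all add: graded_dual_simps(4-6))

text \<open>Zero and sums of the dual are restricted functions by definition, so every value of a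
  formal sum is extensional, again for arbitrary \<open>\<phi>\<close>.\<close>

lemma formal_eval_graded_dual_extensional:
  "formal_eval (graded_dual R H) \<phi> t \<in> extensional (carrier H)"
  by (cases t) (simp_all add: graded_dual_simps(4-6))

context graded_bialgebra_finite
begin

interpretation dual: module R "graded_dual R H"
  by (rule module_graded_dual)

text \<open>The combinatorial core. Factor \<open>i\<close> on the left is the form at position
  \<open>\<sigma> i\<close>, applied to the part of degree \<open>\<alpha> ! i\<close> of
  \<open>hs ! i\<close>. This is factor \<open>\<sigma> i\<close> on the right, so the two products
  in the commutative ring differ by reindexing along \<sigma>.\<close>

lemma pure_pairing_permute_proj:
  assumes "length \<alpha> = k" "\<sigma> permutes {..<k}" and fs: "fs \<in> tuples (graded_dual R H) k"
    and hs: "hs \<in> tuples H k"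
  shows "pure_pairing R (evals hs) (map2 (graded_proj (graded_dual R H)) \<alpha> (permute_list \<sigma> fs)) =
    pure_pairing R (evals (map2 (graded_proj H) (permute_list (inv_into UNIV \<sigma>) \<alpha>)
      (permute_list (inv_into UNIV \<sigma>) hs))) fs"
proof -
  let ?\<tau> = "inv_into UNIV \<sigma>"
  define v where "v j = (fs ! j) (graded_proj H (\<alpha> ! ?\<tau> j) (hs ! ?\<tau> j))" for j
  have \<sigma>: "\<sigma> i < k" if "i < k" for i
    using that permutes_in_image[OF assms(2), of i] by simp
  have \<tau>: "?\<tau> i < k" if "i < k" for i
    using that permutes_in_image[OF permutes_inv[OF assms(2)], of i] by simp
  have f: "fs ! i \<in> carrier (graded_dual R H)" and h: "hs ! i \<in> carrier H" if "i < k" for i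
    using that tuples_nth[OF fs] tuples_nth[OF hs] by auto
  have v: "v j \<in> carrier R" if "j < k" for j
    using module_homD(1)[OF graded_dual_form[OF f[OF that]] graded_proj_closed[OF h[OF \<tau>[OF that]]]]
    by (simp add: v_def)
  have len: "length fs = k" "length hs = k"
    using fs hs by (auto simp: tuples_def)
  have left: "(evals hs ! i) (map2 (graded_proj (graded_dual R H)) \<alpha> (permute_list \<sigma> fs) ! i) = v (\<sigma> i)"
    if "i < k" for i
    using that len assms(1) \<sigma>[OF that] h[OF that] permutes_inverses(2)[OF assms(2), of i]
    by (simp add: v_def permute_list_def graded_proj_dual[OF f[OF \<sigma>[OF that]]])
  have right: "(evals (map2 (graded_proj H) (permute_list ?\<tau> \<alpha>) (permute_list ?\<tau> hs)) ! i) (fs ! i) = v i"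
    if "i < k" for i
    using that len assms(1) \<tau>[OF that] by (simp add: v_def permute_list_def)
  have "pure_pairing R (evals hs) (map2 (graded_proj (graded_dual R H)) \<alpha> (permute_list \<sigma> fs)) =
      finprod R (\<lambda>i. v (\<sigma> i)) {..<k}"
    using left v \<sigma> len assms(1)
    by (subst R.pure_pairing_finprod) (auto intro!: R.finprod_cong')
  also have "\<dots> = finprod R v (\<sigma> ` {..<k})"
    using v \<sigma> permutes_inj_on[OF assms(2)] by (intro R.finprod_reindex[symmetric]) auto
  also have "\<dots> = finprod R v {..<k}"
    by (simp add: permutes_image[OF assms(2)])
  also have "\<dots> = pure_pairing R (evals (map2 (graded_proj H) (permute_list ?\<tau> \<alpha>) (permute_list ?\<tau> hs))) fs"
    using right v len assms(1)
    by (subst R.pure_pairing_finprod) (auto intro!: R.finprod_cong')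
  finally show ?thesis .
qed

lemma p_endo_graded_dual:
  assumes \<alpha>: "length \<alpha> = k" and \<sigma>: "\<sigma> permutes {..<k}" and f: "f \<in> carrier (graded_dual R H)"
  shows "p_endo R (graded_dual R H) \<alpha> \<sigma> f =
    dual_map H (p_endo R H (permute_list (inv_into UNIV \<sigma>) \<alpha>) (inv_into UNIV \<sigma>)) f"
proof (rule extensionalityI)
  let ?D = "graded_dual R H" and ?R = "ring_as_module R" and ?\<tau> = "inv_into UNIV \<sigma>"
  let ?prod = "\<lambda>hs. foldr (\<lambda>x y. x \<otimes>\<^bsub>H\<^esub> y) hs \<one>\<^bsub>H\<^esub>"
  let ?twist = "\<lambda>hs. map2 (graded_proj H) (permute_list ?\<tau> \<alpha>) (permute_list ?\<tau> hs)"
  show "p_endo R ?D \<alpha> \<sigma> f \<in> extensional (carrier H)"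
    by (simp add: p_endo_def iter_mult_def tensor_lift_def formal_eval_graded_dual_extensional)
  show "dual_map H (p_endo R H (permute_list ?\<tau> \<alpha>) ?\<tau>) f \<in> extensional (carrier H)"
    by (simp add: dual_map_def)
  fix h assume h: "h \<in> carrier H"
  define F where "F = iter_comult R ?D k f"
  define S where "S = iter_comult R H k h"
  define T where "T = tensor_proj R ?D \<alpha> (tensor_permute R ?D k ?\<tau> F)"
  have F: "F \<in> carrier (tensor_power R ?D k)"
    and F_val: "\<And>hs. hs \<in> tuples H k \<Longrightarrow> form_lift R (evals hs) F = f (?prod hs)"
    using iter_comult_graded_dual[OF f, where k = k] by (auto simp: F_def)
  have S: "S \<in> carrier (tensor_power R H k)"
    using iter_comult_closed[OF h] by (simp add: S_def)
  note \<tau> = permutes_inv[OF \<sigma>]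
  \<comment> \<open>The action of a permutation rearranges lists by its inverse, and
    \<open>p_endo\<close> acts by the inverse of its argument. So lists over D are rearranged by
    \<sigma>, and lists over H, where the argument is already inverted, by the inverse of
    \<sigma>.\<close>
  have inv_\<tau>: "inv_into UNIV ?\<tau> = \<sigma>"
    using permutes_inv_inv[OF \<sigma>] .
  have \<alpha>_\<tau>: "length (permute_list ?\<tau> \<alpha>) = k"
    using \<alpha> by simp
  have dual_lift: "multilinear R ?D k ?R (pure_pairing R (evals hs))" if "hs \<in> tuples H k" for hs
    using dual.multilinear_pure_pairing[OF evals_forms[OF that]] that by (simp add: tuples_def)
  have T: "T \<in> carrier (tensor_power R ?D k)"
    unfolding T_def
    using tensor_lift_proj_permute(1)[OF module_graded_dual dual.module_tensor_power
        dual.multilinear_pure_tensor \<alpha> \<tau> graded_proj_dual_hom F] .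
  have twist: "?twist hs \<in> tuples H k" if "hs \<in> tuples H k" for hs
    using tuples_map2[OF tuples_permute[OF that \<tau>] \<alpha>_\<tau>] graded_proj_closed by blast
  \<comment> \<open>The tensor \<open>T\<close> is known only through pairings with pure tensors
    over H. Here the twist by \<sigma> and \<alpha> moves from the forms to the points, after which
    the iterated comultiplication of \<open>f\<close> can be evaluated.\<close>
  have T_val: "tensor_lift ?R (\<lambda>fs. pure_pairing R fs hs) T = f (?prod (?twist hs))"
    if hs: "hs \<in> tuples H k" for hs
  proof -
    have "tensor_lift ?R (\<lambda>fs. pure_pairing R fs hs) T = form_lift R (evals hs) T"
      using hs by (intro dual.tensor_lift_cong[OF _ T]) (simp add: pure_pairing_evals tuples_def)
    also have "\<dots> = tensor_lift ?R (\<lambda>fs. pure_pairing R (evals hs)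
        (map2 (graded_proj ?D) \<alpha> (permute_list (inv_into UNIV ?\<tau>) fs))) F"
      unfolding T_def
      using tensor_lift_proj_permute(2)[OF module_graded_dual module_R dual_lift[OF hs]
          \<alpha> \<tau> graded_proj_dual_hom F] .
    also have "\<dots> = form_lift R (evals (?twist hs)) F"
      unfolding inv_\<tau>
      using pure_pairing_permute_proj[OF \<alpha> \<sigma> _ hs] by (intro dual.tensor_lift_cong[OF _ F])
    also have "\<dots> = f (?prod (?twist hs))"
      by (rule F_val[OF twist[OF hs]])
    finally show ?thesis .
  qed
  have fs_forms: "set fs \<subseteq> forms" "length fs = k" if "fs \<in> tuples ?D k" for fs
    using that graded_dual_form by (auto simp: tuples_def)
  have "p_endo R ?D \<alpha> \<sigma> f h =
      tensor_lift ?R (\<lambda>fs. foldr (\<lambda>x y. x \<otimes>\<^bsub>?D\<^esub> y) fs \<one>\<^bsub>?D\<^esub> h) T"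
    using \<alpha> by (simp add: p_endo_def iter_mult_def tensor_lift_def formal_eval_graded_dual[OF h]
        T_def F_def)
  also have "\<dots> = tensor_lift ?R (\<lambda>fs. tensor_lift ?R (pure_pairing R fs) S) T"
    using fs_forms convolution_prod_list[OF _ h]
    by (intro dual.tensor_lift_cong[OF _ T]) (simp add: graded_dual_simps(2,3) S_def)
  \<comment> \<open>Convolution leaves the sum over \<open>T\<close> outside; it has to be the inner
    one before \<open>T_val\<close> applies.\<close>
  also have "\<dots> = tensor_lift ?R (\<lambda>hs. tensor_lift ?R (\<lambda>fs. pure_pairing R fs hs) T) S"
    using pure_pairing_closed fs_forms by (intro dual.tensor_lift_swap[OF module_axioms T S]) blast
  also have "\<dots> = tensor_lift ?R (\<lambda>hs. f (?prod (?twist hs))) S"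
    by (rule tensor_lift_cong[OF T_val S])
  \<comment> \<open>From here on the computation runs backwards: the twist of the tuples is
    reassembled into maps on tensors over H, and then \<open>f\<close> is taken out of the
    lift.\<close>
  also have "\<dots> = tensor_lift ?R (\<lambda>hs. f (?prod hs))
      (tensor_proj R H (permute_list ?\<tau> \<alpha>) (tensor_permute R H k \<sigma> S))"
    using tensor_lift_proj_permute(2)[OF module_axioms module_R
        multilinear_hom_compose[OF multilinear_prod_list graded_dual_form[OF f]]
        \<alpha>_\<tau> \<sigma> graded_proj_hom S] by simp
  also have "\<dots> = f (iter_mult H (tensor_proj R H (permute_list ?\<tau> \<alpha>) (tensor_permute R H k \<sigma> S)))"
    unfolding iter_mult_def
    using tensor_lift_proj_permute(1)[OF module_axioms module_tensor_power
        multilinear_pure_tensor \<alpha>_\<tau> \<sigma> graded_proj_hom S]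
      multilinear_funcset[OF multilinear_prod_list]
    by (intro hom_tensor_lift[OF module_axioms module_R graded_dual_form[OF f], symmetric])
  also have "\<dots> = dual_map H (p_endo R H (permute_list ?\<tau> \<alpha>) ?\<tau>) f h"
    using h \<alpha> by (simp add: dual_map_def p_endo_def inv_\<tau> S_def)
  finally show "p_endo R ?D \<alpha> \<sigma> f h = dual_map H (p_endo R H (permute_list ?\<tau> \<alpha>) ?\<tau>) f h" .
qed

end

text \<open>Positions are counted from 0, and
  \<open>permute_list (inv_into UNIV \<sigma>) \<alpha>\<close> is the right action of the inverse
  of \<sigma> on \<alpha>. Functions in HOL are total, so the two endomorphisms are compared after
  restriction to the carrier of the graded dual.\<close>

theorem proposition1p40:
  fixes R :: "('a, 'r) ring_scheme"
    and H :: "('a, 'b, 'h) graded_bialgebra_scheme"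
    and \<alpha> :: "nat list" and k :: nat and \<sigma> :: "nat \<Rightarrow> nat"
  assumes "graded_bialgebra R H"
    and "\<And>n. finite_free R H (component H n)"
    and "length \<alpha> = k"
    and "\<sigma> permutes {..<k}"
  shows "restrict (p_endo R (graded_dual R H) \<alpha> \<sigma>) (carrier (graded_dual R H)) =
    restrict (dual_map H (p_endo R H (permute_list (inv_into UNIV \<sigma>) \<alpha>) (inv_into UNIV \<sigma>)))
      (carrier (graded_dual R H))"
proof -
  interpret graded_bialgebra_finite R H
    using assms(1,2) by (intro graded_bialgebra_finite.intro graded_bialgebra_finite_axioms.intro)
  show ?thesis
    using p_endo_graded_dual[OF assms(3,4)] by (rule restrict_ext)
qed

end
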